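(* Let $A\in\mathbb{R}^{m\times n}$, let $k\ge1$, $s\ge0$, $p\ge0$ be integers, and let $\Omega\in\mathbb{R}^{n\times(k+s)}$ be such that the block Krylov matrix $K=[A\Omega,\ (AA^{\mathrm T})A\Omega,\ \dots,\ (AA^{\mathrm T})^pA\Omega]\in\mathbb{R}^{m\times (k+s)(p+1)}$ has full column rank. Then, in exact arithmetic and with the same matrix $\Omega$, the algorithm rSVD-BKI is equivalent to the original block Krylov iteration (BKI) algorithm: the set of all pairs $(U,\,USV^{\mathrm T})$ arising from outputs $(U,S,V)$ of rSVD-BKI coincides, up to reversing the order of the $k$ columns of the first component, with the set of all pairs $(Z,\,ZZ^{\mathrm T}A)$ arising from outputs $Z$ of the original BKI algorithm. (Both algorithms are defined in the context.)
   Context: All matrices are real and all computations are in exact arithmetic. In practice $\Omega$ is a Gaussian i.i.d. random matrix; here it is treated as a given matrix shared by both algorithms. Subroutines (each may return any matrices satisfying its specification; the "possible outputs" of an algorithm are all those arising from admissible choices of the subroutines): - $\mathrm{orth}(X)$, for $X$ of full column rank: a matrix of the same size as $X$ with orthonormal columns and the same column space as $X$. - $\mathrm{lu}(K)$, for $K\in\mathbb{R}^{m\times r}$ of full column rank: compute a pivoted LU factorization $PK=LU$ ($P$ an $m\times m$ permutation matrix, $L\in\mathbb{R}^{m\times r}$ lower triangular (trapezoidal) with unit diagonal, $U\in\mathbb{R}^{r\times r}$ upper triangular); the first output of $\mathrm{lu}(K)$ is $P^{\mathrm T}L$. - $\mathrm{eigSVD}(A)$, for $A\in\mathbb{R}^{m\times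 n}$ with $m\ge n$ and full column rank: (1) $B=A^{\mathrm T}A$; (2) $[V,D]=\mathrm{eig}(B)$, i.e. $B=VDV^{\mathrm T}$ with $V$ orthogonal and $D$ diagonal with entries in ascending order; (3) $S=D^{1/2}$; (4) $U=AVS^{-1}$. Output: $[U,S,V]$. Original BKI algorithm (input $A,\Omega,k,s,p$): form $K=[A\Omega,(AA^{\mathrm T})A\Omega,\dots,(AA^{\mathrm T})^pA\Omega]$; let $Q=\mathrm{orth}(K)$; form $M=Q^{\mathrm T}AA^{\mathrm T}Q$; let $\bar U_k$ be a matrix whose columns are $k$ orthonormal leading eigenvectors of $M$ (for the $k$ largest eigenvalues, in descending order); output $Z=Q\bar U_k\in\mathbb{R}^{m\times k}$. The associated rank-$k$ approximation of $A$ is $ZZ^{\mathrm T}A$. rSVD-BKI (input $A,\Omega,k,s,p$): 1. $H_0$ = first output of $\mathrm{lu}(A\Omega)$. 2. For $i=1,\dots,p$: $H_i$ = first output of $\mathrm{lu}(A(A^{\mathrm T}H_{i-1}))$. 3. $H=[H_0,H_1,\dots,H_p]$; $Q=\mathrm{orth}(H)$; $B=Q^{\mathrm T}A$. 4. $[V,S,U]=\mathrm{eigSVD}(B^{\mathrm T})$. 5. With $ind=\{(k+s)(p+1)-k+1,\dots,(k+s)(p+1)\}$, output $U=Q\,U(:,ind)$, $S=S(ind,ind)$, $V=V(:,ind)$. *)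

theory Defs
  imports
    "Jordan_Normal_Form.DL_Rank"
    "Jordan_Normal_Form.DL_Submatrix"
    "Jordan_Normal_Form.Char_Poly"
    Complex_Main
begin

text \<open>
  The subroutines and the two algorithms are nondeterministic, so each is modelled as a relation
  between its inputs and its possible outputs. A subroutine called outside its domain (for instance
  on a matrix that does not have full column rank) has no output. Indices are 0-based throughout.
\<close>

definition full_col_rank :: "real mat \<Rightarrow> bool" where
  "full_col_rank X \<longleftrightarrow> vec_space.rank (dim_row X) X = dim_col X"

definition orthonormal_cols :: "real mat \<Rightarrow> bool" where
  "orthonormal_cols X \<longleftrightarrow> X\<^sup>T * X = 1\<^sub>m (dim_col X)"

definition hcat :: "nat \<Rightarrow> real mat list \<Rightarrow> real mat" where
  "hcat m Xs = mat_of_cols m (concat (map cols Xs))"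

definition rev_cols :: "real mat \<Rightarrow> real mat" where
  "rev_cols X = mat_of_cols (dim_row X) (rev (cols X))"

definition orth :: "real mat \<Rightarrow> real mat \<Rightarrow> bool" where
  "orth X Q \<longleftrightarrow> full_col_rank X
     \<and> Q \<in> carrier_mat (dim_row X) (dim_col X)
     \<and> orthonormal_cols Q
     \<and> vec_space.col_space (dim_row X) Q = vec_space.col_space (dim_row X) X"

definition permutation_mat :: "nat \<Rightarrow> real mat \<Rightarrow> bool" where
  "permutation_mat m P \<longleftrightarrow>
     (\<exists>\<pi>. \<pi> permutes {..<m} \<and> P = mat m m (\<lambda>(i, j). if \<pi> i = j then 1 else 0))"

definition unit_lower_trapezoidal :: "real mat \<Rightarrow> bool" where
  "unit_lower_trapezoidal L \<longleftrightarrow>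
     (\<forall>i < dim_row L. \<forall>j < dim_col L.
        (i < j \<longrightarrow> L $$ (i, j) = 0) \<and> (i = j \<longrightarrow> L $$ (i, j) = 1))"

text \<open>
  \<open>lu_fst K W\<close>: \<open>W\<close> is a possible first output of \<open>lu(K)\<close>. No pivoting rule is imposed
  beyond \<open>P K = L U\<close>.
\<close>
definition lu_fst :: "real mat \<Rightarrow> real mat \<Rightarrow> bool" where
  "lu_fst K W \<longleftrightarrow> full_col_rank K
     \<and> (\<exists>P L U. permutation_mat (dim_row K) P
          \<and> L \<in> carrier_mat (dim_row K) (dim_col K) \<and> unit_lower_trapezoidal L
          \<and> U \<in> carrier_mat (dim_col K) (dim_col K) \<and> upper_triangular U
          \<and> P * K = L * U
          \<and> W = P\<^sup>T * L)"

text \<open>\<open>eig B V D\<close>: an orthogonal diagonalisation with the eigenvalues in ascending order.\<close>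
definition eig :: "real mat \<Rightarrow> real mat \<Rightarrow> real mat \<Rightarrow> bool" where
  "eig B V D \<longleftrightarrow> (let n = dim_row B in
       V \<in> carrier_mat n n \<and> orthonormal_cols V
     \<and> D \<in> carrier_mat n n \<and> diagonal_mat D
     \<and> (\<forall>j < n. \<forall>i \<le> j. D $$ (i, i) \<le> D $$ (j, j))
     \<and> B = V * D * V\<^sup>T)"

text \<open>
  Since \<open>D\<close> is diagonal, with nonnegative entries, and \<open>sqrt 0 = 0\<close>, the entrywise square root
  \<open>map_mat sqrt D\<close> is \<open>D\<close> to the power \<open>1/2\<close>.
\<close>
definition eigSVD :: "real mat \<Rightarrow> real mat \<Rightarrow> real mat \<Rightarrow> real mat \<Rightarrow> bool" where
  "eigSVD A U S V \<longleftrightarrow> dim_col A \<le> dim_row A \<and> full_col_rank A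
     \<and> (\<exists>D. eig (A\<^sup>T * A) V D \<and> S = map_mat sqrt D)
     \<and> (\<exists>T \<in> carrier_mat (dim_col A) (dim_col A).
          inverts_mat S T \<and> inverts_mat T S \<and> U = A * V * T)"

text \<open>
  The list \<open>es\<close> consists of all eigenvalues of \<open>M\<close>, repeated according to multiplicity, in
  descending order, so that its first \<open>k\<close> entries are the \<open>k\<close> largest eigenvalues.
\<close>
definition leading_eigenvectors :: "real mat \<Rightarrow> nat \<Rightarrow> real mat \<Rightarrow> bool" where
  "leading_eigenvectors M k W \<longleftrightarrow>
       W \<in> carrier_mat (dim_row M) k \<and> orthonormal_cols W
     \<and> (\<exists>es. char_poly M = (\<Prod>e\<leftarrow>es. [:- e, 1:]) \<and> sorted_wrt (\<ge>) es
          \<and> (\<forall>j < k. eigenvector M (col W j) (es ! j)))"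

definition krylov :: "real mat \<Rightarrow> real mat \<Rightarrow> nat \<Rightarrow> real mat" where
  "krylov A \<Omega> p = hcat (dim_row A) (map (\<lambda>i. (A * A\<^sup>T) ^\<^sub>m i * A * \<Omega>) [0..<Suc p])"

definition BKI :: "real mat \<Rightarrow> real mat \<Rightarrow> nat \<Rightarrow> nat \<Rightarrow> nat \<Rightarrow> real mat \<Rightarrow> bool" where
  "BKI A \<Omega> k s p Z \<longleftrightarrow>
     (\<exists>Q W. orth (krylov A \<Omega> p) Q
        \<and> leading_eigenvectors (Q\<^sup>T * A * A\<^sup>T * Q) k W
        \<and> Z = Q * W)"

text \<open>
  \<open>V'\<close>, \<open>S'\<close>, \<open>U'\<close> are the three outputs of \<open>eigSVD(B\<^sup>T)\<close>, in this order, so \<open>U'\<close> is the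
  square orthogonal factor; \<open>U\<close>, \<open>S\<close>, \<open>V\<close> are the final outputs.
\<close>
definition rSVD_BKI ::
  "real mat \<Rightarrow> real mat \<Rightarrow> nat \<Rightarrow> nat \<Rightarrow> nat \<Rightarrow> real mat \<Rightarrow> real mat \<Rightarrow> real mat \<Rightarrow> bool" where
  "rSVD_BKI A \<Omega> k s p U S V \<longleftrightarrow>
     (\<exists>H Q B V' S' U'.
          lu_fst (A * \<Omega>) (H 0)
        \<and> (\<forall>i \<in> {1..p}. lu_fst (A * (A\<^sup>T * H (i - 1))) (H i))
        \<and> orth (hcat (dim_row A) (map H [0..<Suc p])) Q
        \<and> B = Q\<^sup>T * A
        \<and> eigSVD B\<^sup>T V' S' U'
        \<and> (let q = (k + s) * (p + 1); ind = {q - k..<q} in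
             U = Q * submatrix U' UNIV ind
           \<and> S = submatrix S' ind ind
           \<and> V = submatrix V' UNIV ind))"

end

theory Submission
  imports Defs
begin

text \<open>
  Every pivoted LU step only multiplies its argument on the right by an invertible matrix, so
  \<open>H\<^sub>i = (A A\<^sup>T)\<^sup>i A \<Omega> R\<^sub>i\<close> with \<open>R\<^sub>i\<close> invertible; hence \<open>H\<close> and \<open>K\<close> have the same column
  space, and the two algorithms admit the same matrices \<open>Q\<close>. For such a \<open>Q\<close>, the matrix
  \<open>(Q\<^sup>T A)\<^sup>T\<close> has full column rank because the range of \<open>Q\<close> lies in that of \<open>A\<close>. The
  orthogonal factor of \<open>eigSVD((Q\<^sup>T A)\<^sup>T)\<close> diagonalises \<open>M = Q\<^sup>T A A\<^sup>T Q\<close> with ascending eigenvalues, so its last \<open>k\<close>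
  columns, reversed, are leading eigenvectors of \<open>M\<close>; conversely \<open>k\<close> orthonormal leading
  eigenvectors extend to an orthonormal eigenbasis with the remaining eigenvalues in order. Finally,
  \<open>V S = (Q\<^sup>T A)\<^sup>T U'\<close> survives the truncation because \<open>S\<close> is diagonal, which turns \<open>U S V\<^sup>T\<close> into
  \<open>U U\<^sup>T A\<close>.
\<close>

section \<open>Full column rank\<close>

text \<open>The library rank is the dimension of the span of the set of columns, in which repeated
  columns collapse. Distinctness of the columns is therefore settled first in either direction; only
  then do independence of the set and a trivial kernel mean the same.\<close>

lemma full_col_rank_iff:
  "full_col_rank X \<longleftrightarrow> (\<forall>v \<in> carrier_vec (dim_col X). X *\<^sub>v v = 0\<^sub>v (dim_row X) \<longrightarrow> v = 0\<^sub>v (dim_col X))"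
  (is "_ \<longleftrightarrow> ?inj")
proof -
  interpret vec_space "TYPE(real)" "dim_row X" .
  have X: "X \<in> carrier_mat (dim_row X) (dim_col X)" by simp
  show ?thesis
  proof
    assume "full_col_rank X"
    then have r: "rank X = dim_col X" by (simp add: full_col_rank_def)
    have d: "distinct (cols X)"
    proof (rule ccontr)
      \<comment> \<open>With a repetition, the column set, and hence any maximal independent subset
        of it, has fewer than \<open>dim_col X\<close> elements, but the size of such a subset is
        the rank.\<close>
      assume "\<not> distinct (cols X)"
      then have "card (set (cols X)) < dim_col X"
        by (metis card_distinct card_length cols_length le_neq_implies_less)
      moreover obtain S where S: "maximal S (\<lambda>T. T \<subseteq> set (cols X) \<and> lin_indpt T)"
        using maximal_exists[of "(\<lambda>T. T \<subseteq> set (cols X) \<and> lin_indpt T)" "card (set (cols X))" "{}"]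
        by (meson List.finite_set card_mono empty_iff empty_subsetI finite_lin_indpt2 rev_finite_subset)
      moreover have "card S \<le> card (set (cols X))" using S by (simp add: card_mono maximal_def)
      ultimately show False using rank_card_indpt[OF X S] r by simp
    qed
    show ?inj using lin_depI[OF X _ _ _ d] full_rank_lin_indpt[OF X r d] by blast
  next
    assume inj: ?inj
    have "distinct (cols X)"
    proof (rule ccontr)
      assume "\<not> distinct (cols X)"
      then obtain i j where ij: "i < dim_col X" "j < dim_col X" "i \<noteq> j" "col X i = col X j"
        by (auto simp: distinct_conv_nth)
      \<comment> \<open>Two equal columns put the difference of the corresponding unit vectors into
        the kernel.\<close>
      define v where "v = unit_vec (dim_col X) i - (unit_vec (dim_col X) j :: real vec)"
      have v: "v \<in> carrier_vec (dim_col X)" by (simp add: v_def)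
      have "col X i $ a = col X j $ a" if "a < dim_row X" for a using ij(4) by simp
      then have "X *\<^sub>v v = 0\<^sub>v (dim_row X)"
        using ij(1,2) by (auto simp: v_def scalar_prod_minus_distrib[of _ "dim_col X"] intro!: eq_vecI)
      then have "v = 0\<^sub>v (dim_col X)" using inj v by blast
      moreover have "v $ i = 1" using ij by (simp add: v_def)
      ultimately show False using ij(1) by simp
    qed
    moreover have "lin_indpt (set (cols X))"
      using lin_depE[OF X _ calculation] inj by metis
    ultimately show "full_col_rank X"
      unfolding full_col_rank_def by (rule lin_indpt_full_rank[OF X])
  qed
qed

lemma full_col_rankD:
  assumes "full_col_rank X" "X \<in> carrier_mat m n" "v \<in> carrier_vec n" "X *\<^sub>v v = 0\<^sub>v m"
  shows "v = 0\<^sub>v n"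
  using assms unfolding full_col_rank_iff by auto

lemma full_col_rankI:
  assumes "X \<in> carrier_mat m n"
    and "\<And>v. v \<in> carrier_vec n \<Longrightarrow> X *\<^sub>v v = 0\<^sub>v m \<Longrightarrow> v = 0\<^sub>v n"
  shows "full_col_rank X"
  using assms unfolding full_col_rank_iff by auto

lemma full_col_rank_mult_invertible:
  assumes X: "X \<in> carrier_mat m n" "full_col_rank X" and R: "R \<in> carrier_mat n n" "R' \<in> carrier_mat n n"
    and RR: "R' * R = 1\<^sub>m n"
  shows "full_col_rank (X * R)"
proof (rule full_col_rankI)
  show "X * R \<in> carrier_mat m n" using assms by auto
  fix v :: "real vec" assume v: "v \<in> carrier_vec n" "X * R *\<^sub>v v = 0\<^sub>v m"
  then have "X *\<^sub>v (R *\<^sub>v v) = 0\<^sub>v m" using X R by (simp add: assoc_mult_mat_vec)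
  then have "R *\<^sub>v v = 0\<^sub>v n" using full_col_rankD[OF X(2,1)] R v by auto
  then have "R' *\<^sub>v (R *\<^sub>v v) = 0\<^sub>v n" using R by auto
  then show "v = 0\<^sub>v n" using v R RR assoc_mult_mat_vec[OF R(2,1) v(1)] by simp
qed

lemma col_space_mult_subset:
  fixes X :: "real mat"
  assumes "X \<in> carrier_mat m n" "R \<in> carrier_mat n l"
  shows "vec_space.col_space m (X * R) \<subseteq> vec_space.col_space m X"
proof -
  interpret vec_space "TYPE(real)" m .
  have XR: "X * R \<in> carrier_mat m l" using assms by auto
  show ?thesis
    unfolding col_space_eq[OF XR] col_space_eq[OF assms(1)]
    using assms by (auto simp: assoc_mult_mat_vec intro!: bexI[of _ "R *\<^sub>v x" for x])
qed

lemma invertible_of_full_col_rank: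
  assumes U: "U \<in> carrier_mat n n" and "full_col_rank U"
  obtains R where "R \<in> carrier_mat n n" "U * R = 1\<^sub>m n" "R * U = 1\<^sub>m n"
proof -
  have "det U \<noteq> 0"
    unfolding det_0_iff_vec_prod_zero[OF U] using full_col_rankD[OF assms(2,1)] by blast
  from det_non_zero_imp_unit[OF U this, of undefined] that show ?thesis
    by (auto simp: Units_def ring_mat_def)
qed

text \<open>The \<open>j < n\<close> vectors become the first rows of a square matrix padded with
  zero rows. Row \<open>j\<close> is zero, so the determinant vanishes and the kernel is
  nontrivial.\<close>

lemma wide_matrix_kernel:
  assumes "\<And>i. i < j \<Longrightarrow> f i \<in> carrier_vec n" "j < n"
  obtains v :: "real vec" where "v \<in> carrier_vec n" "v \<noteq> 0\<^sub>v n" "\<And>i. i < j \<Longrightarrow> f i \<bullet> v = 0"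
proof -
  define C where "C = mat\<^sub>r n n (\<lambda>i. if i = j then 0\<^sub>v n else if i < j then f i else 0\<^sub>v n)"
  have C: "C \<in> carrier_mat n n" by (simp add: C_def)
  have "det C = 0" unfolding C_def
    by (rule det_row_0) (use assms in auto)
  then obtain v where v: "v \<in> carrier_vec n" "v \<noteq> 0\<^sub>v n" "C *\<^sub>v v = 0\<^sub>v n"
    using det_0_iff_vec_prod_zero[OF C] by blast
  have "f i \<bullet> v = 0" if "i < j" for i
  proof -
    have "row C i = f i" using that assms(1)[OF that] assms(2) unfolding C_def by (auto simp: row_mat_of_row_fun)
    moreover have "(C *\<^sub>v v) $ i = row C i \<bullet> v" using that assms(2) C by auto
    ultimately show ?thesis using v(3) that assms(2) by simp
  qed
  with v that show ?thesis by blast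
qed

lemma full_col_rank_le:
  assumes X: "X \<in> carrier_mat m n" and "full_col_rank X"
  shows "n \<le> m"
proof (rule ccontr)
  assume "\<not> n \<le> m"
  then obtain v where v: "v \<in> carrier_vec n" "v \<noteq> 0\<^sub>v n" "\<And>i. i < m \<Longrightarrow> row X i \<bullet> v = 0"
    using wide_matrix_kernel[of m "row X" n] X by (metis not_le row_carrier_vec carrier_matD)
  have "X *\<^sub>v v = 0\<^sub>v m" using v X by auto
  then show False using full_col_rankD[OF assms(2,1)] v by blast
qed

section \<open>Pivoted LU factorization\<close>

text \<open>
  Here \<open>K j\<close> is the \<open>j\<close>-th column and \<open>\<sigma> i\<close> the \<open>i\<close>-th pivot row. The last conjunct keeps the
  columns produced by later elimination steps zero in the pivot rows used before.
\<close>
lemma pivoted_elimination: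
  fixes K :: "nat \<Rightarrow> nat \<Rightarrow> real"
  assumes "\<And>c. (\<forall>x<m. (\<Sum>j<r. c j * K j x) = 0) \<Longrightarrow> \<forall>j<r. c j = 0"
  shows "\<exists>\<sigma> w u. (\<forall>i<r. \<sigma> i < m \<and> w i (\<sigma> i) = 1 \<and> (\<forall>l<i. w i (\<sigma> l) = 0))
    \<and> (\<forall>j<r. \<forall>x<m. K j x = (\<Sum>l\<le>j. w l x * u l j))
    \<and> (\<forall>x<m. (\<forall>j<r. K j x = 0) \<longrightarrow> (\<forall>i<r. w i x = 0))"
  using assms
proof (induction r arbitrary: K)
  case 0
  then show ?case by simp
next
  case (Suc r)
  have "\<exists>a<m. K 0 a \<noteq> 0"
  proof (rule ccontr)
    assume "\<not> (\<exists>a<m. K 0 a \<noteq> 0)"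
    then have "\<forall>x<m. (\<Sum>j<Suc r. (if j = 0 then 1 else 0) * K j x) = 0"
      by (auto intro!: sum.neutral)
    from Suc.prems[OF this] show False by auto
  qed
  then obtain a where a: "a < m" "K 0 a \<noteq> 0" by blast
  \<comment> \<open>Gaussian elimination: \<open>w0\<close> is the first column scaled to 1 in the
    pivot row \<open>a\<close>, and \<open>K'\<close> holds the later columns after their entries in
    that row have been cleared with \<open>w0\<close>.\<close>
  define w0 where "w0 x = K 0 x / K 0 a" for x
  define K' where "K' j x = K (Suc j) x - w0 x * K (Suc j) a" for j x
  have indep: "\<forall>j<r. c j = 0" if c: "\<forall>x<m. (\<Sum>j<r. c j * K' j x) = 0" for c
  proof -
    \<comment> \<open>The coefficient of column 0 collects the multiples of \<open>w0\<close>
      subtracted in \<open>K'\<close>, so a dependence among the reduced columns lifts to one among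
      the original columns.\<close>
    define d where "d = case_nat (- (\<Sum>j<r. c j * K (Suc j) a) / K 0 a) c"
    have "(\<Sum>j<Suc r. d j * K j x) = (\<Sum>j<r. c j * K' j x)" for x
      by (simp add: sum.lessThan_Suc_shift d_def K'_def w0_def right_diff_distrib sum_subtractf
          sum_distrib_left sum_distrib_right sum_divide_distrib sum_negf mult_ac del: sum.lessThan_Suc)
    with c have "\<forall>x<m. (\<Sum>j<Suc r. d j * K j x) = 0" by simp
    from Suc.prems[OF this] show ?thesis by (auto simp: d_def)
  qed
  obtain \<sigma> w u where IH: "\<forall>i<r. \<sigma> i < m \<and> w i (\<sigma> i) = 1 \<and> (\<forall>l<i. w i (\<sigma> l) = 0)"
    "\<forall>j<r. \<forall>x<m. K' j x = (\<Sum>l\<le>j. w l x * u l j)"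
    "\<forall>x<m. (\<forall>j<r. K' j x = 0) \<longrightarrow> (\<forall>i<r. w i x = 0)"
    using Suc.IH[OF indep] by blast
  \<comment> \<open>Row 0 of the new triangular factor is the pivot row of \<open>K\<close>; the
    remaining rows come from the recursion with both indices shifted by one.\<close>
  define u' where "u' l j = (case l of 0 \<Rightarrow> K j a | Suc l' \<Rightarrow> u l' (j - 1))" for l j
  have w0a: "w0 a = 1" using a by (simp add: w0_def)
  \<comment> \<open>All of \<open>K'\<close> vanishes in row \<open>a\<close> because
    \<open>w0 a = 1\<close>; the last conjunct of the induction hypothesis passes this on to every
    later \<open>w i\<close>.\<close>
  have "w i a = 0" if "i < r" for i
    using IH(3) a(1) that w0a by (simp add: K'_def)
  then have 1: "\<forall>i<Suc r. case_nat a \<sigma> i < m \<and> case_nat w0 w i (case_nat a \<sigma> i) = 1 \<and>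
      (\<forall>l<i. case_nat w0 w i (case_nat a \<sigma> l) = 0)"
    using IH(1) a w0a by (auto split: nat.splits)
  have 2: "K j x = (\<Sum>l\<le>j. case_nat w0 w l x * u' l j)" if "j < Suc r" "x < m" for j x
  proof (cases j)
    case 0
    then show ?thesis using a by (simp add: u'_def w0_def)
  next
    case (Suc j')
    then have "K' j' x = (\<Sum>l\<le>j'. w l x * u l j')" using IH(2) that by simp
    then show ?thesis unfolding Suc sum.atMost_Suc_shift by (simp add: K'_def u'_def)
  qed
  have 3: "\<forall>x<m. (\<forall>j<Suc r. K j x = 0) \<longrightarrow> (\<forall>i<Suc r. case_nat w0 w i x = 0)"
    using IH(3) by (auto simp: w0_def K'_def split: nat.splits)
  show ?case using 1 2 3 by blast
qed

text \<open>The indices from \<open>r\<close> on and the values missed by the injection are equally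
  many, so any bijection between the two sets completes it to a permutation.\<close>

lemma inj_on_extend_permutes:
  assumes "inj_on \<sigma> {..<r}" "\<sigma> ` {..<r} \<subseteq> {..<m :: nat}"
  obtains \<pi> where "\<pi> permutes {..<m}" "\<And>i. i < r \<Longrightarrow> \<pi> i = \<sigma> i" "r \<le> m"
proof -
  have c: "card (\<sigma> ` {..<r}) = r" using assms(1) by (simp add: card_image)
  then have rm: "r \<le> m" using card_mono[OF _ assms(2)] by simp
  have "card {r..<m} = card ({..<m} - \<sigma> ` {..<r})"
    using c assms(2) by (simp add: card_Diff_subset)
  then obtain h where h: "bij_betw h {r..<m} ({..<m} - \<sigma> ` {..<r})"
    by (metis finite_same_card_bij finite_atLeastLessThan finite_lessThan finite_Diff)
  define g where "g i = (if i < r then \<sigma> i else h i)" for i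
  have "bij_betw g {..<r} (\<sigma> ` {..<r})"
    using assms(1) by (auto simp: bij_betw_def inj_on_def g_def)
  moreover have "bij_betw g {r..<m} ({..<m} - \<sigma> ` {..<r})"
    using h by (subst bij_betw_cong[where g = h]) (auto simp: g_def)
  ultimately have "bij_betw g ({..<r} \<union> {r..<m}) (\<sigma> ` {..<r} \<union> ({..<m} - \<sigma> ` {..<r}))"
    by (intro bij_betw_combine) auto
  moreover have "{..<r} \<union> {r..<m} = {..<m}" "\<sigma> ` {..<r} \<union> ({..<m} - \<sigma> ` {..<r}) = {..<m}"
    using rm assms(2) by auto
  ultimately have g: "bij_betw g {..<m} {..<m}" by simp
  define \<pi> where "\<pi> i = (if i < m then g i else i)" for i
  have "bij_betw \<pi> {..<m} {..<m}"
    using g by (subst bij_betw_cong[where g = g]) (auto simp: \<pi>_def)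
  then have "\<pi> permutes {..<m}"
    by (rule bij_imp_permutes) (simp add: \<pi>_def)
  then show ?thesis using that[of \<pi>] rm by (auto simp: \<pi>_def g_def)
qed

section \<open>Permutation matrices\<close>

lemma permutation_mat_mult_index:
  assumes "\<pi> permutes {..<m}" "K \<in> carrier_mat m r" "i < m" "j < r"
  shows "(mat m m (\<lambda>(i, j). if \<pi> i = j then 1 else 0) * K) $$ (i, j) = (K $$ (\<pi> i, j) :: real)"
proof -
  have "\<pi> i < m" using permutes_in_image[OF assms(1), of i] assms(3) by simp
  have "(mat m m (\<lambda>(i, j). if \<pi> i = j then 1 else 0) * K) $$ (i, j)
    = (\<Sum>x = 0..<m. (if \<pi> i = x then 1 else 0) * K $$ (x, j))"
    using assms(2-) by (simp add: scalar_prod_def)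
  also have "\<dots> = (\<Sum>x = 0..<m. if \<pi> i = x then K $$ (x, j) else 0)"
    by (rule sum.cong) auto
  also have "\<dots> = K $$ (\<pi> i, j)" using \<open>\<pi> i < m\<close> by simp
  finally show ?thesis .
qed

lemma permutation_mat_orthogonal:
  assumes "permutation_mat m P"
  shows "P \<in> carrier_mat m m" "P\<^sup>T * P = 1\<^sub>m m"
proof -
  obtain \<pi> where \<pi>: "\<pi> permutes {..<m}" and P: "P = mat m m (\<lambda>(i, j). if \<pi> i = j then 1 else 0)"
    using assms unfolding permutation_mat_def by blast
  show Pc: "P \<in> carrier_mat m m" by (simp add: P)
  have "P * P\<^sup>T = 1\<^sub>m m"
  proof (rule eq_matI)
    fix i j assume ij: "i < dim_row (1\<^sub>m m :: real mat)" "j < dim_col (1\<^sub>m m :: real mat)"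
    then have "\<pi> i < m" "\<pi> j < m" using permutes_in_image[OF \<pi>] by auto
    have "(P * P\<^sup>T) $$ (i, j) = P\<^sup>T $$ (\<pi> i, j)"
      unfolding P using ij by (intro permutation_mat_mult_index[OF \<pi>, where r = m]) auto
    also have "\<dots> = (1\<^sub>m m) $$ (i, j)"
      using ij \<open>\<pi> i < m\<close> \<open>\<pi> j < m\<close> permutes_inj[OF \<pi>] by (auto simp: P dest: injD)
    finally show "(P * P\<^sup>T) $$ (i, j) = 1\<^sub>m m $$ (i, j)" .
  qed (simp_all add: P)
  then show "P\<^sup>T * P = 1\<^sub>m m"
    using mat_mult_left_right_inverse[OF Pc transpose_carrier_mat[THEN iffD2, OF Pc]] by simp
qed

text \<open>Independent columns never run out of pivots, so elimination with row exchanges succeeds.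
  This supplies outputs of the LU calls when a BKI output has to be reproduced by rSVD-BKI.\<close>

lemma lu_fst_exists:
  assumes "full_col_rank K"
  shows "\<exists>W. lu_fst K W"
proof -
  define m r where "m = dim_row K" and "r = dim_col K"
  have K: "K \<in> carrier_mat m r" by (simp add: m_def r_def)
  have indep: "\<forall>j<r. c j = 0" if "\<forall>x<m. (\<Sum>j<r. c j * K $$ (x, j)) = 0" for c
  proof -
    have "K *\<^sub>v vec r c = 0\<^sub>v m"
      using that K by (auto simp: scalar_prod_def atLeast0LessThan mult.commute intro!: eq_vecI)
    then have "vec r c = 0\<^sub>v r" using full_col_rankD[OF assms K] by simp
    then show ?thesis by (metis index_vec index_zero_vec(1))
  qed
  obtain \<sigma> w u where 1: "\<forall>i<r. \<sigma> i < m \<and> w i (\<sigma> i) = 1 \<and> (\<forall>l<i. w i (\<sigma> l) = 0)"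
    and 2: "\<forall>j<r. \<forall>x<m. K $$ (x, j) = (\<Sum>l\<le>j. w l x * u l j)"
    using pivoted_elimination[where K = "\<lambda>j x. K $$ (x, j)", OF indep] by blast
  \<comment> \<open>Pivot rows do not repeat: for \<open>l < i\<close> the column \<open>w i\<close>
    is 0 in row \<open>\<sigma> l\<close> but 1 in row \<open>\<sigma> i\<close>.\<close>
  have "\<sigma> l \<noteq> \<sigma> i" if "l < i" "i < r" for l i using 1 that by (metis zero_neq_one)
  then have "inj_on \<sigma> {..<r}" by (auto simp: inj_on_def) (metis linorder_neqE_nat)
  moreover have "\<sigma> ` {..<r} \<subseteq> {..<m}" using 1 by auto
  ultimately obtain \<pi> where \<pi>: "\<pi> permutes {..<m}" "\<And>i. i < r \<Longrightarrow> \<pi> i = \<sigma> i" "r \<le> m"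
    by (rule inj_on_extend_permutes) blast
  define P where "P = (mat m m (\<lambda>(i, j). if \<pi> i = j then 1 else 0) :: real mat)"
  \<comment> \<open>The permutation moves pivot row \<open>\<sigma> i\<close> to position
    \<open>i\<close>. The ones in the pivot rows then form the diagonal of \<open>L\<close>, and the
    zeros in earlier pivot rows lie above it.\<close>
  define L where "L = mat m r (\<lambda>(i, j). w j (\<pi> i))"
  define U where "U = mat r r (\<lambda>(l, j). if l \<le> j then u l j else 0)"
  have "P * K = L * U"
  proof (rule eq_matI)
    fix i j assume ij: "i < dim_row (L * U)" "j < dim_col (L * U)"
    then have i: "i < m" and j: "j < r" by (auto simp: L_def U_def)
    have "\<pi> i < m" using permutes_in_image[OF \<pi>(1), of i] i by simp
    have "(P * K) $$ (i, j) = K $$ (\<pi> i, j)"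
      unfolding P_def by (rule permutation_mat_mult_index[OF \<pi>(1) K i j])
    also have "\<dots> = (\<Sum>l\<le>j. w l (\<pi> i) * u l j)" using 2 j \<open>\<pi> i < m\<close> by simp
    also have "\<dots> = (\<Sum>l = 0..<r. w l (\<pi> i) * (if l \<le> j then u l j else 0))"
      using j by (intro sum.mono_neutral_cong_left) auto
    also have "\<dots> = (L * U) $$ (i, j)"
      using i j by (simp add: L_def U_def scalar_prod_def)
    finally show "(P * K) $$ (i, j) = (L * U) $$ (i, j)" .
  qed (use K in \<open>auto simp: P_def L_def U_def\<close>)
  moreover have "unit_lower_trapezoidal L"
    using 1 \<pi> by (auto simp: unit_lower_trapezoidal_def L_def)
  moreover have "permutation_mat m P" using \<pi>(1) by (auto simp: permutation_mat_def P_def)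
  moreover have "upper_triangular U" by (auto simp: U_def upper_triangular_def)
  moreover have "L \<in> carrier_mat m r" "U \<in> carrier_mat r r" by (auto simp: L_def U_def)
  ultimately have "lu_fst K (P\<^sup>T * L)"
    unfolding lu_fst_def m_def[symmetric] r_def[symmetric] using assms by blast
  then show ?thesis ..
qed

text \<open>Orthogonality of \<open>P\<close> turns \<open>P K = L U\<close> into
  \<open>K = W U\<close>. A kernel vector of \<open>U\<close> would be one of \<open>K\<close>, so
  \<open>U\<close> is invertible and its inverse is \<open>R\<close>.\<close>

lemma lu_fst_column_equivalent:
  assumes "lu_fst K W" and K: "K \<in> carrier_mat m r"
  obtains R R' where "R \<in> carrier_mat r r" "R' \<in> carrier_mat r r"
    "R * R' = 1\<^sub>m r" "R' * R = 1\<^sub>m r" "W = K * R"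
proof -
  obtain P L U where P: "permutation_mat m P" and L: "L \<in> carrier_mat m r"
    and U: "U \<in> carrier_mat r r" and PK: "P * K = L * U" and W: "W = P\<^sup>T * L" and rk: "full_col_rank K"
    using assms unfolding lu_fst_def by auto
  note Po = permutation_mat_orthogonal[OF P]
  have Pt: "P\<^sup>T \<in> carrier_mat m m" using Po by simp
  have Wc: "W \<in> carrier_mat m r" using Pt L W by simp
  have "W * U = P\<^sup>T * (P * K)" unfolding W PK using Pt L U by (simp add: assoc_mult_mat)
  also have "\<dots> = P\<^sup>T * P * K" using assoc_mult_mat[OF Pt Po(1) K] by simp
  also have "\<dots> = K" using Po K by simp
  finally have WU: "W * U = K" .
  have "full_col_rank U"
  proof (rule full_col_rankI[OF U])
    fix v :: "real vec" assume v: "v \<in> carrier_vec r" "U *\<^sub>v v = 0\<^sub>v r"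
    have "K *\<^sub>v v = W *\<^sub>v (U *\<^sub>v v)" unfolding WU[symmetric] by (rule assoc_mult_mat_vec[OF Wc U v(1)])
    also have "\<dots> = 0\<^sub>v m" using v Wc by auto
    finally show "v = 0\<^sub>v r" using full_col_rankD[OF rk K] v by blast
  qed
  from invertible_of_full_col_rank[OF U this] obtain R where
    R: "R \<in> carrier_mat r r" "U * R = 1\<^sub>m r" "R * U = 1\<^sub>m r" by blast
  have "K * R = W * (U * R)" unfolding WU[symmetric] by (rule assoc_mult_mat[OF Wc U R(1)])
  then have "W = K * R" using R Wc by simp
  with R U that show ?thesis by blast
qed

section \<open>Block matrices\<close>

lemma length_concat_cols:
  assumes "\<And>i. i < t \<Longrightarrow> F i \<in> carrier_mat m r"
  shows "length (concat (map cols (map F [0..<t]))) = t * r"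
  using assms by (induction t) (auto simp: carrier_matD)

lemma hcat_carrier:
  assumes "\<And>i. i < t \<Longrightarrow> F i \<in> carrier_mat m r"
  shows "hcat m (map F [0..<t]) \<in> carrier_mat m (t * r)"
  using length_concat_cols[of t F, OF assms] by (auto simp: hcat_def)

lemma hcat_index:
  assumes "\<And>i. i < t \<Longrightarrow> F i \<in> carrier_mat m r" "a < m" "c < t * r"
  shows "hcat m (map F [0..<t]) $$ (a, c) = F (c div r) $$ (a, c mod r)"
proof -
  have "concat (map cols (map F [0..<t])) ! c = col (F (c div r)) (c mod r)"
    using assms(1,3)
  proof (induction t)
    case (Suc t)
    have L: "length (concat (map cols (map F [0..<t]))) = t * r" by (rule length_concat_cols[of t F m]) (use Suc.prems(1) in simp)
    show ?case
    proof (cases "c < t * r")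
      case True
      then show ?thesis using Suc L by (simp add: nth_append)
    next
      case False
      then obtain d where d: "c = t * r + d" by (metis le_add_diff_inverse not_less)
      with Suc.prems(2) have "d < r" by simp
      with d have "c div r = t" "c mod r = d" by auto
      then show ?thesis
        using L d \<open>d < r\<close> Suc.prems(1)[of t] by (simp add: nth_append)
    qed
  qed simp
  moreover have "0 < r" using assms(3) by (cases r) auto
  then have "c mod r < r" "c div r < t"
    using assms(3) by (auto simp: less_mult_imp_div_less)
  ultimately show ?thesis
    using assms length_concat_cols[of t F, OF assms(1)] unfolding hcat_def
    by (subst mat_of_cols_index) (auto dest: assms(1))
qed

lemma sum_blocks:
  fixes g :: "nat \<Rightarrow> real"
  shows "(\<Sum>x<t * r. g x) = (\<Sum>y<t. \<Sum>x<r. g (y * r + x))"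
proof -
  have "(\<Sum>x = y * r..<y * r + r. g x) = (\<Sum>x<r. g (y * r + x))" for y
    using sum.shift_bounds_nat_ivl[of g 0 "y * r" r] by (simp add: atLeast0LessThan add.commute)
  then show ?thesis by (simp flip: sum.nat_group)
qed

definition block_diag :: "nat \<Rightarrow> nat \<Rightarrow> (nat \<Rightarrow> real mat) \<Rightarrow> real mat" where
  "block_diag t r R = mat (t * r) (t * r)
     (\<lambda>(a, b). if a div r = b div r then R (a div r) $$ (a mod r, b mod r) else 0)"

text \<open>The sum over all columns splits into sums over blocks, and only the block with index
  \<open>c div r\<close> contributes to column \<open>c\<close>.\<close>

lemma hcat_mult_block_diag:
  assumes F: "\<And>i. i < t \<Longrightarrow> F i \<in> carrier_mat m r" and R: "\<And>i. i < t \<Longrightarrow> R i \<in> carrier_mat r r"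
  shows "hcat m (map F [0..<t]) * block_diag t r R = hcat m (map (\<lambda>i. F i * R i) [0..<t])"
proof (rule eq_matI)
  have FR: "\<And>i. i < t \<Longrightarrow> F i * R i \<in> carrier_mat m r" using F R by (metis mult_carrier_mat)
  note hF = hcat_carrier[of t F, OF F] and hFR = hcat_carrier[of t "\<lambda>i. F i * R i", OF FR]
  show "dim_row (hcat m (map F [0..<t]) * block_diag t r R) = dim_row (hcat m (map (\<lambda>i. F i * R i) [0..<t]))"
    "dim_col (hcat m (map F [0..<t]) * block_diag t r R) = dim_col (hcat m (map (\<lambda>i. F i * R i) [0..<t]))"
    using hF hFR by (auto simp: block_diag_def)
  fix a c assume "a < dim_row (hcat m (map (\<lambda>i. F i * R i) [0..<t]))"
    "c < dim_col (hcat m (map (\<lambda>i. F i * R i) [0..<t]))"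
  then have a: "a < m" and c: "c < t * r" using hFR by auto
  have r: "0 < r" using c by (cases r) auto
  have cd: "c mod r < r" "c div r < t" using c r by (auto simp: less_mult_imp_div_less)
  have "(hcat m (map F [0..<t]) * block_diag t r R) $$ (a, c) =
    (\<Sum>x<t * r. hcat m (map F [0..<t]) $$ (a, x) * block_diag t r R $$ (x, c))"
    using a c hF by (simp add: scalar_prod_def atLeast0LessThan block_diag_def)
  also have "\<dots> = (\<Sum>x<t * r. F (x div r) $$ (a, x mod r) *
      (if x div r = c div r then R (x div r) $$ (x mod r, c mod r) else 0))"
    by (rule sum.cong) (use a c hcat_index[of t F, OF F] in \<open>auto simp: block_diag_def\<close>)
  also have "\<dots> = (\<Sum>y<t. \<Sum>x<r. F y $$ (a, x) * (if y = c div r then R y $$ (x, c mod r) else 0))"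
    unfolding sum_blocks by (intro sum.cong refl) auto
  also have "\<dots> = (\<Sum>y<t. if y = c div r then \<Sum>x<r. F y $$ (a, x) * R y $$ (x, c mod r) else 0)"
    by (rule sum.cong) auto
  also have "\<dots> = (\<Sum>x<r. F (c div r) $$ (a, x) * R (c div r) $$ (x, c mod r))"
    using cd by simp
  also have "\<dots> = (F (c div r) * R (c div r)) $$ (a, c mod r)"
    using a cd F[OF cd(2)] R[OF cd(2)] by (simp add: scalar_prod_def atLeast0LessThan)
  also have "\<dots> = hcat m (map (\<lambda>i. F i * R i) [0..<t]) $$ (a, c)"
    using hcat_index[of t "\<lambda>i. F i * R i", OF FR a c] by simp
  finally show "(hcat m (map F [0..<t]) * block_diag t r R) $$ (a, c) =
    hcat m (map (\<lambda>i. F i * R i) [0..<t]) $$ (a, c)" .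
qed

lemma hcat_col_space_subset:
  assumes "\<And>i. i < t \<Longrightarrow> F i \<in> carrier_mat m r" "\<And>i. i < t \<Longrightarrow> R i \<in> carrier_mat r r"
  shows "vec_space.col_space m (hcat m (map (\<lambda>i. F i * R i) [0..<t]))
    \<subseteq> vec_space.col_space m (hcat m (map F [0..<t]))"
proof -
  have "hcat m (map (\<lambda>i. F i * R i) [0..<t]) = hcat m (map F [0..<t]) * block_diag t r R"
    by (rule hcat_mult_block_diag[symmetric]) (use assms in auto)
  moreover have "hcat m (map F [0..<t]) \<in> carrier_mat m (t * r)"
    by (rule hcat_carrier) (use assms in auto)
  moreover have "block_diag t r R \<in> carrier_mat (t * r) (t * r)" by (simp add: block_diag_def)
  ultimately show ?thesis using col_space_mult_subset by metis
qed

text \<open>A kernel vector of one block, padded by zeros in the positions of the other blocks, is a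
  kernel vector of the concatenation.\<close>

lemma hcat_block_full_col_rank:
  assumes F: "\<And>i. i < t \<Longrightarrow> F i \<in> carrier_mat m r" and "full_col_rank (hcat m (map F [0..<t]))" and i: "i < t"
  shows "full_col_rank (F i)"
proof (rule full_col_rankI[OF F[OF i]])
  fix v :: "real vec" assume v: "v \<in> carrier_vec r" "F i *\<^sub>v v = 0\<^sub>v m"
  show "v = 0\<^sub>v r"
  proof (cases "r = 0")
    case True
    then show ?thesis using v by auto
  next
    case False
    define w where "w = vec (t * r) (\<lambda>x. if x div r = i then v $ (x mod r) else 0)"
    have hF: "hcat m (map F [0..<t]) \<in> carrier_mat m (t * r)" by (rule hcat_carrier[of t F, OF F])
    have "(hcat m (map F [0..<t]) *\<^sub>v w) $ a = 0" if a: "a < m" for a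
    proof -
      have "(hcat m (map F [0..<t]) *\<^sub>v w) $ a = (\<Sum>x<t * r. hcat m (map F [0..<t]) $$ (a, x) * w $ x)"
        using a hF by (simp add: scalar_prod_def atLeast0LessThan w_def)
      also have "\<dots> = (\<Sum>x<t * r. F (x div r) $$ (a, x mod r) * (if x div r = i then v $ (x mod r) else 0))"
        by (rule sum.cong) (use a hcat_index[of t F, OF F] in \<open>auto simp: w_def\<close>)
      also have "\<dots> = (\<Sum>y<t. \<Sum>x<r. F y $$ (a, x) * (if y = i then v $ x else 0))"
        unfolding sum_blocks by (intro sum.cong refl) auto
      also have "\<dots> = (\<Sum>y<t. if y = i then \<Sum>x<r. F y $$ (a, x) * v $ x else 0)"
        by (rule sum.cong) auto
      also have "\<dots> = (F i *\<^sub>v v) $ a"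
        using i a F[OF i] v(1) by (simp add: scalar_prod_def atLeast0LessThan)
      finally show ?thesis using v(2) a by simp
    qed
    then have "hcat m (map F [0..<t]) *\<^sub>v w = 0\<^sub>v m" using hF by (auto intro!: eq_vecI)
    then have w0: "w = 0\<^sub>v (t * r)" using full_col_rankD[OF assms(2) hF] by (simp add: w_def)
    have "v $ x = 0" if x: "x < r" for x
    proof -
      have "i * r + x < Suc i * r" using x by simp
      also have "\<dots> \<le> t * r" using i by (intro mult_right_mono) auto
      finally have "i * r + x < t * r" .
      moreover from this have "w $ (i * r + x) = v $ x" using x by (simp add: w_def)
      ultimately show ?thesis by (simp add: w0)
    qed
    then show ?thesis using v(1) by (auto intro!: eq_vecI)
  qed
qed

section \<open>Dependence of rank and \<open>orth\<close> on the column space alone\<close>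

lemma full_col_rank_cong:
  assumes "X \<in> carrier_mat m n" "Y \<in> carrier_mat m n" "vec_space.col_space m X = vec_space.col_space m Y"
  shows "full_col_rank X \<longleftrightarrow> full_col_rank Y"
proof -
  have "vec_space.rank m X = vec_space.rank m Y"
    using assms(3) unfolding vec_space.rank_def vec_space.col_space_def by simp
  then show ?thesis using assms by (auto simp: full_col_rank_def)
qed

lemma orth_cong:
  assumes "X \<in> carrier_mat m n" "Y \<in> carrier_mat m n" "vec_space.col_space m X = vec_space.col_space m Y"
  shows "orth X Q \<longleftrightarrow> orth Y Q"
  using full_col_rank_cong[OF assms] assms by (auto simp: orth_def)

section \<open>Orthonormal eigenbases of symmetric matrices\<close>

lemma scalar_prod_self_pos:
  assumes "v \<in> carrier_vec n" "v \<noteq> 0\<^sub>v n"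
  shows "v \<bullet> v > (0 :: real)"
proof -
  obtain i where "i < n" "v $ i \<noteq> 0" using assms by (metis carrier_vecD eq_vecI index_zero_vec)
  then have "(\<Sum>i = 0..<n. v $ i * v $ i) > 0" by (intro sum_pos2[of _ i]) (auto simp: zero_less_mult_iff)
  then show ?thesis using assms(1) by (simp add: scalar_prod_def)
qed

text \<open>While fewer than \<open>n\<close> vectors are present, \<open>wide_matrix_kernel\<close>
  yields a nonzero vector orthogonal to all of them, which is normalised and appended. The induction
  counts the missing vectors.\<close>

lemma orthonormal_extend:
  assumes "\<And>a. a < j \<Longrightarrow> f a \<in> carrier_vec n"
    and "\<And>a b. a < j \<Longrightarrow> b < j \<Longrightarrow> f a \<bullet> f b = (if a = b then 1 else 0 :: real)" "j \<le> n"
  shows "\<exists>g. (\<forall>a<j. g a = f a) \<and> (\<forall>a<n. g a \<in> carrier_vec n)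
      \<and> (\<forall>a<n. \<forall>b<n. g a \<bullet> g b = (if a = b then 1 else 0))"
  using assms
  proof (induction "n - j" arbitrary: j f)
    case 0
    then show ?case by (intro exI[of _ f]) auto
  next
    case (Suc d)
    then have "j < n" by simp
    with Suc.prems(1) obtain v where v: "v \<in> carrier_vec n" "v \<noteq> 0\<^sub>v n" "\<And>i. i < j \<Longrightarrow> f i \<bullet> v = 0"
      using wide_matrix_kernel[of j f n] by metis
    have vv: "v \<bullet> v > 0" using v(1,2) by (rule scalar_prod_self_pos)
    define h where "h a = (if a < j then f a else (1 / sqrt (v \<bullet> v)) \<cdot>\<^sub>v v)" for a
    have vf: "v \<bullet> f a = 0" if "a < j" for a
      using comm_scalar_prod[OF v(1) Suc.prems(1)[OF that]] v(3)[OF that] by simp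
    have 1: "h a \<in> carrier_vec n" for a using Suc.prems(1) v(1) by (simp add: h_def)
    have 2: "h a \<bullet> h b = (if a = b then 1 else 0)" if ab: "a < Suc j" "b < Suc j" for a b
      using ab vv v vf Suc.prems(1,2)
      by (cases "a < j"; cases "b < j") (auto simp: h_def field_simps less_Suc_eq)
    have d: "d = n - Suc j" using Suc.hyps(2) by simp
    obtain g where g: "\<forall>a<Suc j. g a = h a" "\<forall>a<n. g a \<in> carrier_vec n"
      "\<forall>a<n. \<forall>b<n. g a \<bullet> g b = (if a = b then 1 else 0)"
      using Suc.hyps(1)[OF d 1 2] \<open>j < n\<close> by auto
    then show ?case by (intro exI[of _ g]) (auto simp: h_def)
  qed

section \<open>Characteristic polynomials that split into linear factors\<close>

lemma char_poly_four_block_diag: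
  assumes A: "A \<in> carrier_mat n n" and D: "D \<in> carrier_mat m m"
  shows "char_poly (four_block_mat A (0\<^sub>m n m) (0\<^sub>m m n) (D :: real mat)) = char_poly A * char_poly D"
proof -
  have "char_poly_matrix (four_block_mat A (0\<^sub>m n m) (0\<^sub>m m n) D) =
      four_block_mat (char_poly_matrix A) (0\<^sub>m n m) (0\<^sub>m m n) (char_poly_matrix D)"
    using A D by (intro eq_matI) (auto simp: char_poly_matrix_def one_poly_def)
  then show ?thesis
    unfolding char_poly_def
    by (simp only:) (rule det_four_block_mat_lower_left_zero[OF _ _ refl], use A D in auto)
qed

lemma prod_list_linear_nonzero:
  "(\<Prod>e\<leftarrow>es. [:- e, 1:]) \<noteq> (0 :: real poly)"
  by (induction es) (simp_all del: mult_pCons_left)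

lemma degree_prod_list_linear:
  "degree (\<Prod>e\<leftarrow>es. [:- e, 1:] :: real poly) = length es"
  using prod_list_linear_nonzero
  by (induction es) (auto simp: degree_mult_eq simp del: mult_pCons_left)

lemma length_eigenvalues:
  assumes "M \<in> carrier_mat n n" "char_poly M = (\<Prod>e\<leftarrow>es. [:- e, 1:] :: real poly)"
  shows "length es = n"
  using degree_monic_char_poly[OF assms(1)] degree_prod_list_linear[of es] assms(2) by simp

definition mat_of_fun_cols :: "nat \<Rightarrow> nat \<Rightarrow> (nat \<Rightarrow> real vec) \<Rightarrow> real mat" where
  "mat_of_fun_cols n k g = mat n k (\<lambda>(a, b). g b $ a)"

lemma mat_of_fun_cols:
  "mat_of_fun_cols n k g \<in> carrier_mat n k"
  "b < k \<Longrightarrow> g b \<in> carrier_vec n \<Longrightarrow> col (mat_of_fun_cols n k g) b = g b"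
  by (auto simp: mat_of_fun_cols_def)

lemma orthonormal_cols_iff:
  assumes "V \<in> carrier_mat n k"
  shows "orthonormal_cols V \<longleftrightarrow> (\<forall>a<k. \<forall>b<k. col V a \<bullet> col V b = (if a = b then 1 else 0))"
  unfolding orthonormal_cols_def using assms
  by (auto simp: mat_eq_iff)

text \<open>Deflation with a prescribed next eigenvalue: in an orthonormal basis starting with the
  known eigenvectors, \<open>M\<close> splits into a diagonal block and a remainder
  \<open>N2\<close>. Cancelling the known linear factors shows that \<open>es ! j\<close> is a root
  of the characteristic polynomial of \<open>N2\<close>. Multiplicities are thus respected, also
  when \<open>es ! j\<close> equals an earlier eigenvalue.\<close>

lemma eigenbasis_extend_one:
  fixes M :: "real mat"
  assumes M: "M \<in> carrier_mat n n" "M\<^sup>T = M" and cp: "char_poly M = (\<Prod>e\<leftarrow>es. [:- e, 1:])"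
    and f: "\<And>a. a < j \<Longrightarrow> f a \<in> carrier_vec n"
    "\<And>a b. a < j \<Longrightarrow> b < j \<Longrightarrow> f a \<bullet> f b = (if a = b then 1 else 0)"
    "\<And>a. a < j \<Longrightarrow> M *\<^sub>v f a = es ! a \<cdot>\<^sub>v f a"
    and j: "j < n"
  obtains v where "v \<in> carrier_vec n" "v \<bullet> v = 1" "\<And>a. a < j \<Longrightarrow> f a \<bullet> v = 0" "M *\<^sub>v v = es ! j \<cdot>\<^sub>v v"
proof -
  have len: "length es = n" by (rule length_eigenvalues[OF M(1) cp])
  obtain h where h: "\<And>a. a < j \<Longrightarrow> h a = f a" "\<And>a. a < n \<Longrightarrow> h a \<in> carrier_vec n"
    "\<And>a b. a < n \<Longrightarrow> b < n \<Longrightarrow> h a \<bullet> h b = (if a = b then 1 else 0)"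
    using orthonormal_extend[OF f(1,2) less_imp_le[OF j]] by blast
  define G where "G = mat_of_fun_cols n n h"
  have G: "G \<in> carrier_mat n n" "G\<^sup>T \<in> carrier_mat n n" by (auto simp: G_def mat_of_fun_cols)
  have colG: "col G a = h a" if "a < n" for a using that h(2) by (simp add: G_def mat_of_fun_cols)
  have GG: "G\<^sup>T * G = 1\<^sub>m n"
    using orthonormal_cols_iff[OF G(1)] h(3) colG G by (simp add: orthonormal_cols_def)
  have GG': "G * G\<^sup>T = 1\<^sub>m n" by (rule mat_mult_left_right_inverse[OF G(2,1) GG])
  define N where "N = G\<^sup>T * (M * G)"
  have N: "N \<in> carrier_mat n n" using G M by (simp add: N_def)
  have GN: "G * N = M * G"
    unfolding N_def using assoc_mult_mat[of G n n "G\<^sup>T" n "M * G" n] G M GG' by simp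
  have MN: "M = G * N * G\<^sup>T"
    unfolding GN using assoc_mult_mat[OF M(1) G] GG' M by simp
  have cpN: "char_poly N = char_poly M"
    by (rule char_poly_similar[symmetric], rule similar_matI[of _ _ G "G\<^sup>T" n])
      (use G N M GG GG' MN in auto)
  have "N\<^sup>T = G\<^sup>T * M * G"
    unfolding N_def using G M by (simp add: transpose_mult[of _ n n _ n])
  then have Nsym: "N\<^sup>T = N" unfolding N_def using G M by (simp add: assoc_mult_mat[of _ n n _ n _ n])
  have Nl: "N $$ (a, b) = (if a = b then es ! b else 0)" if "a < n" "b < j" for a b
  proof -
    have "N $$ (a, b) = col G a \<bullet> col (M * G) b" using that j G M by (simp add: N_def)
    also have "col (M * G) b = M *\<^sub>v h b" using that j G M colG[of b] by (subst col_mult2[of _ n n _ n]) auto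
    also have "\<dots> = es ! b \<cdot>\<^sub>v h b" using h(1) f(3) that by simp
    also have "col G a \<bullet> \<dots> = (if a = b then es ! b else 0)"
      using that j h(2,3)[of a] h(2)[of b] by (simp add: colG)
    finally show ?thesis .
  qed
  \<comment> \<open>Symmetry carries the zeros of the first \<open>j\<close> columns over to the
    first \<open>j\<close> rows, which makes \<open>N\<close> block diagonal.\<close>
  have Nu: "N $$ (b, a) = (if a = b then es ! b else 0)" if "a < n" "b < j" for a b
    using Nl[OF that] Nsym N that j by (metis index_transpose_mat(1) carrier_matD less_trans)
  define D where "D = mat j j (\<lambda>(a, b). if a = b then es ! b else (0 :: real))"
  define N2 where "N2 = mat (n - j) (n - j) (\<lambda>(a, b). N $$ (a + j, b + j))"
  have D: "D \<in> carrier_mat j j" and N2: "N2 \<in> carrier_mat (n - j) (n - j)" by (auto simp: D_def N2_def)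
  have Nblock: "N = four_block_mat D (0\<^sub>m j (n - j)) (0\<^sub>m (n - j) j) N2"
    using N j Nl Nu by (intro eq_matI) (auto simp: D_def N2_def)
  have "char_poly D = (\<Prod>e\<leftarrow>diag_mat D. [:- e, 1:])"
    by (rule char_poly_upper_triangular[OF D]) (auto simp: D_def upper_triangular_def)
  also have "diag_mat D = take j es"
    using len j by (auto simp: diag_mat_def D_def intro!: nth_equalityI)
  finally have "char_poly N = (\<Prod>e\<leftarrow>take j es. [:- e, 1:]) * char_poly N2"
    unfolding Nblock char_poly_four_block_diag[OF D N2] by simp
  moreover have "char_poly N = (\<Prod>e\<leftarrow>take j es. [:- e, 1:]) * (\<Prod>e\<leftarrow>drop j es. [:- e, 1:])"
    unfolding cpN cp by (metis append_take_drop_id map_append prod_list.append)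
  \<comment> \<open>The common factor of the first \<open>j\<close> eigenvalues is a nonzero
    polynomial and cancels.\<close>
  ultimately have "char_poly N2 = (\<Prod>e\<leftarrow>drop j es. [:- e, 1:])"
    using prod_list_linear_nonzero by simp
  also have "drop j es = es ! j # drop (Suc j) es" using j len by (simp add: Cons_nth_drop_Suc)
  finally have "poly (char_poly N2) (es ! j) = 0" by simp
  then obtain z where z: "z \<in> carrier_vec (n - j)" "z \<noteq> 0\<^sub>v (n - j)" "N2 *\<^sub>v z = es ! j \<cdot>\<^sub>v z"
    using eigenvalue_root_char_poly[OF N2] N2 by (auto simp: eigenvalue_def eigenvector_def)
  \<comment> \<open>The eigenvector of the remainder block is padded with \<open>j\<close> zeros.
    These make its image under \<open>G\<close> orthogonal to the given \<open>f a\<close>.\<close>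
  define u where "u = 0\<^sub>v j @\<^sub>v z"
  have u: "u \<in> carrier_vec n" using append_carrier_vec[OF zero_carrier_vec[of j] z(1)] j by (simp add: u_def)
  have u0: "u $ a = 0" if "a < j" for a using that z(1) by (simp add: u_def)
  have "N *\<^sub>v u = (D *\<^sub>v 0\<^sub>v j + 0\<^sub>m j (n - j) *\<^sub>v z) @\<^sub>v (0\<^sub>m (n - j) j *\<^sub>v 0\<^sub>v j + N2 *\<^sub>v z)"
    unfolding Nblock u_def by (rule four_block_mat_mult_vec[OF D _ _ N2]) (use z(1) in auto)
  also have "\<dots> = es ! j \<cdot>\<^sub>v u"
    using D z j by (intro eq_vecI) (auto simp: u_def)
  finally have Nu_eig: "N *\<^sub>v u = es ! j \<cdot>\<^sub>v u" .
  define x where "x = G *\<^sub>v u"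
  have x: "x \<in> carrier_vec n" using G u by (simp add: x_def)
  have "M *\<^sub>v x = G * N *\<^sub>v u" unfolding x_def GN using assoc_mult_mat_vec[OF M(1) G(1) u] by simp
  also have "\<dots> = es ! j \<cdot>\<^sub>v x"
    unfolding x_def using assoc_mult_mat_vec[OF G(1) N u] Nu_eig mult_mat_vec[OF G(1) u] by simp
  finally have Mx: "M *\<^sub>v x = es ! j \<cdot>\<^sub>v x" .
  have Gx: "G\<^sup>T *\<^sub>v x = u"
    unfolding x_def using assoc_mult_mat_vec[OF G(2,1) u] GG u by simp
  have "x \<noteq> 0\<^sub>v n"
  proof
    assume "x = 0\<^sub>v n"
    then have "u = 0\<^sub>v n" using Gx G by auto
    have "z $ i = 0" if "i < n - j" for i
    proof -
      have "z $ i = u $ (i + j)" using that z(1) by (simp add: u_def)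
      also have "\<dots> = 0" using that by (simp add: \<open>u = 0\<^sub>v n\<close>)
      finally show ?thesis .
    qed
    then show False using z(1,2) by (auto intro: eq_vecI)
  qed
  then have xx: "x \<bullet> x > 0" by (rule scalar_prod_self_pos[OF x])
  have fx: "f a \<bullet> x = 0" if "a < j" for a
  proof -
    have "f a \<bullet> x = (G\<^sup>T *\<^sub>v x) $ a" using that j G colG[of a] h(1) by simp
    then show ?thesis using Gx u0 that by simp
  qed
  let ?v = "(1 / sqrt (x \<bullet> x)) \<cdot>\<^sub>v x"
  show ?thesis
  proof (rule that[of ?v])
    show "?v \<in> carrier_vec n" using x by simp
    show "?v \<bullet> ?v = 1" using x xx by (simp add: field_simps)
    show "f a \<bullet> ?v = 0" if "a < j" for a using fx that x f(1) by simp
    show "M *\<^sub>v ?v = es ! j \<cdot>\<^sub>v ?v"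
      using mult_mat_vec[OF M(1) x] Mx by (simp add: smult_smult_assoc mult.commute)
  qed
qed

text \<open>Repeated one-vector extension. Position \<open>a\<close> always receives the eigenvalue
  \<open>es ! a\<close>, so the order of the list is kept without any sorting afterwards.\<close>

lemma eigenbasis_extend:
  fixes M :: "real mat"
  assumes M: "M \<in> carrier_mat n n" "M\<^sup>T = M" and cp: "char_poly M = (\<Prod>e\<leftarrow>es. [:- e, 1:])"
    and "\<And>a. a < j \<Longrightarrow> f a \<in> carrier_vec n"
    "\<And>a b. a < j \<Longrightarrow> b < j \<Longrightarrow> f a \<bullet> f b = (if a = b then 1 else 0)"
    "\<And>a. a < j \<Longrightarrow> M *\<^sub>v f a = es ! a \<cdot>\<^sub>v f a"
    and "j \<le> n"
  shows "\<exists>g. (\<forall>a<j. g a = f a) \<and> (\<forall>a<n. g a \<in> carrier_vec n \<and> M *\<^sub>v g a = es ! a \<cdot>\<^sub>v g a)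
      \<and> (\<forall>a<n. \<forall>b<n. g a \<bullet> g b = (if a = b then 1 else 0))"
  using assms(4-)
proof (induction "n - j" arbitrary: j f)
  case 0
  then show ?case by (intro exI[of _ f]) auto
next
  case (Suc d)
  then have "j < n" by simp
  obtain v where v: "v \<in> carrier_vec n" "v \<bullet> v = 1" "\<And>a. a < j \<Longrightarrow> f a \<bullet> v = 0" "M *\<^sub>v v = es ! j \<cdot>\<^sub>v v"
    using eigenbasis_extend_one[OF M cp Suc.prems(1,2,3) \<open>j < n\<close>] by metis
  have vf: "v \<bullet> f a = 0" if "a < j" for a
    using comm_scalar_prod[OF v(1) Suc.prems(1)[OF that]] v(3)[OF that] by simp
  define h where "h a = (if a < j then f a else v)" for a
  have h: "a < Suc j \<Longrightarrow> h a \<in> carrier_vec n"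
    "a < Suc j \<Longrightarrow> b < Suc j \<Longrightarrow> h a \<bullet> h b = (if a = b then 1 else 0)"
    "a < Suc j \<Longrightarrow> M *\<^sub>v h a = es ! a \<cdot>\<^sub>v h a" for a b
    using Suc.prems(1-3) v vf by (auto simp: h_def less_Suc_eq)
  have d: "d = n - Suc j" using Suc.hyps(2) by simp
  obtain g where "\<forall>a<Suc j. g a = h a" "\<forall>a<n. g a \<in> carrier_vec n \<and> M *\<^sub>v g a = es ! a \<cdot>\<^sub>v g a"
    "\<forall>a<n. \<forall>b<n. g a \<bullet> g b = (if a = b then 1 else 0)"
    using Suc.hyps(1)[OF d h] \<open>j < n\<close> by auto
  then show ?case by (intro exI[of _ g]) (auto simp: h_def)
qed

section \<open>Trailing columns and leading eigenvectors\<close>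

lemma rev_cols_eq:
  assumes "X \<in> carrier_mat m k"
  shows "rev_cols X = mat m k (\<lambda>(i, j). X $$ (i, k - 1 - j))"
  using assms by (intro eq_matI) (auto simp: rev_cols_def mat_of_cols_index rev_nth)

lemma rev_cols_mult:
  assumes "Q \<in> carrier_mat m q" "X \<in> carrier_mat q k"
  shows "rev_cols (Q * X) = Q * rev_cols X"
  unfolding rev_cols_eq[OF mult_carrier_mat[OF assms]] rev_cols_eq[OF assms(2)]
  using assms by (intro eq_matI) (auto simp: scalar_prod_def)

text \<open>The product is the sum of the outer products of the columns with themselves, which does
  not see their order. Hence reversing columns leaves the rank-\<open>k\<close> approximation
  unchanged.\<close>

lemma rev_cols_gram:
  assumes X: "X \<in> carrier_mat m k"
  shows "rev_cols X * (rev_cols X)\<^sup>T = X * X\<^sup>T"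
proof (rule eq_matI)
  fix i j assume "i < dim_row (X * X\<^sup>T)" "j < dim_col (X * X\<^sup>T)"
  then have ij: "i < m" "j < m" using X by auto
  have "(rev_cols X * (rev_cols X)\<^sup>T) $$ (i, j) = (\<Sum>x = 0..<k. X $$ (i, k - 1 - x) * X $$ (j, k - 1 - x))"
    unfolding rev_cols_eq[OF X] using ij by (simp add: scalar_prod_def)
  also have "\<dots> = (\<Sum>x = 0..<k. X $$ (i, x) * X $$ (j, x))"
    using sum.nat_diff_reindex[of "\<lambda>x. X $$ (i, x) * X $$ (j, x)" k] by (simp add: atLeast0LessThan)
  also have "\<dots> = (X * X\<^sup>T) $$ (i, j)" using ij X by (simp add: scalar_prod_def)
  finally show "(rev_cols X * (rev_cols X)\<^sup>T) $$ (i, j) = (X * X\<^sup>T) $$ (i, j)" .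
qed (use X in \<open>auto simp: rev_cols_def\<close>)

text \<open>\<open>pick\<close> enumerates a set in increasing order, and exactly \<open>i\<close>
  elements of the interval lie below \<open>q - k + i\<close>.\<close>

lemma pick_last:
  assumes "i < k" "k \<le> q"
  shows "pick {q - k..<q} i = q - k + i"
proof -
  have "{a \<in> {q - k..<q}. a < q - k + i} = {q - k..<q - k + i}" using assms by auto
  then have "card {a \<in> {q - k..<q}. a < q - k + i} = i" by simp
  moreover have "q - k + i \<in> {q - k..<q}" using assms by auto
  ultimately show ?thesis using pick_card_in_set by metis
qed

lemma submatrix_last_cols:
  assumes "X \<in> carrier_mat m q" "k \<le> q"
  shows "submatrix X UNIV {q - k..<q} = mat m k (\<lambda>(i, j). X $$ (i, q - k + j))"
proof -
  have "{j. j < q \<and> q - k \<le> j \<and> j < q} = {q - k..<q}" by auto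
  then have "card {j. j < q \<and> q - k \<le> j \<and> j < q} = k" using assms(2) by simp
  then show ?thesis using assms by (intro eq_matI) (auto simp: submatrix_def pick_UNIV pick_last)
qed

lemma submatrix_last_block:
  assumes "X \<in> carrier_mat q q" "k \<le> q"
  shows "submatrix X {q - k..<q} {q - k..<q} = mat k k (\<lambda>(i, j). X $$ (q - k + i, q - k + j))"
proof -
  have "{j. j < q \<and> q - k \<le> j \<and> j < q} = {q - k..<q}" by auto
  then have "card {j. j < q \<and> q - k \<le> j \<and> j < q} = k" using assms(2) by simp
  then show ?thesis using assms by (intro eq_matI) (auto simp: submatrix_def pick_last)
qed

lemma rev_cols_submatrix_last_cols:
  assumes "X \<in> carrier_mat m q" "k \<le> q"
  shows "rev_cols (submatrix X UNIV {q - k..<q}) = mat m k (\<lambda>(i, j). X $$ (i, q - 1 - j))"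
  unfolding submatrix_last_cols[OF assms] using assms(2)
  by (subst rev_cols_eq[of _ m k]) (auto intro!: eq_matI)

lemma orthonormal_colsD:
  assumes "V \<in> carrier_mat n n" "orthonormal_cols V"
  shows "V\<^sup>T * V = 1\<^sub>m n" "V * V\<^sup>T = 1\<^sub>m n"
proof -
  show VV: "V\<^sup>T * V = 1\<^sub>m n" using assms by (simp add: orthonormal_cols_def)
  show "V * V\<^sup>T = 1\<^sub>m n" using mat_mult_left_right_inverse[OF _ assms(1) VV] assms(1) by simp
qed

section \<open>Orthogonal diagonalisations and leading eigenvectors\<close>

lemma eig_eigenvector:
  assumes "eig M V D" and M: "M \<in> carrier_mat q q" and a: "a < q"
  shows "M *\<^sub>v col V a = D $$ (a, a) \<cdot>\<^sub>v col V a"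
proof -
  have V: "V \<in> carrier_mat q q" "orthonormal_cols V" and D: "D \<in> carrier_mat q q" "diagonal_mat D"
    and MV: "M = V * D * V\<^sup>T"
    using assms by (auto simp: eig_def Let_def)
  have "M * V = V * D * (V\<^sup>T * V)"
    unfolding MV using V(1) D(1) by (simp add: assoc_mult_mat[of _ q q _ q _ q])
  then have MV': "M * V = V * D" using orthonormal_colsD[OF V] V D by simp
  have "M *\<^sub>v col V a = col (M * V) a" using M V(1) a by (subst col_mult2[of _ q q _ q]) auto
  also have "\<dots> = D $$ (a, a) \<cdot>\<^sub>v col V a"
  proof (rule eq_vecI)
    fix i assume "i < dim_vec (D $$ (a, a) \<cdot>\<^sub>v col V a)"
    then have i: "i < q" using V by simp
    have "col (M * V) a $ i = (\<Sum>x = 0..<q. V $$ (i, x) * D $$ (x, a))"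
      unfolding MV' using V D i a by (simp add: scalar_prod_def)
    also have "\<dots> = (\<Sum>x = 0..<q. if x = a then V $$ (i, a) * D $$ (a, a) else 0)"
      using D a by (intro sum.cong) (auto simp: diagonal_mat_def)
    also have "\<dots> = (D $$ (a, a) \<cdot>\<^sub>v col V a) $ i" using i a V by simp
    finally show "col (M * V) a $ i = (D $$ (a, a) \<cdot>\<^sub>v col V a) $ i" .
  qed (use M V in auto)
  finally show ?thesis .
qed

lemma eig_leading_eigenvectors:
  assumes E: "eig M V D" and M: "M \<in> carrier_mat q q" and k: "k \<le> q"
  shows "leading_eigenvectors M k (rev_cols (submatrix V UNIV {q - k..<q}))"
proof -
  have V: "V \<in> carrier_mat q q" "orthonormal_cols V" and D: "D \<in> carrier_mat q q" "diagonal_mat D"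
    and asc: "\<And>i j. j < q \<Longrightarrow> i \<le> j \<Longrightarrow> D $$ (i, i) \<le> D $$ (j, j)" and MV: "M = V * D * V\<^sup>T"
    using assms by (auto simp: eig_def Let_def)
  define W where "W = rev_cols (submatrix V UNIV {q - k..<q})"
  have W_eq: "W = mat q k (\<lambda>(i, j). V $$ (i, q - 1 - j))"
    unfolding W_def by (rule rev_cols_submatrix_last_cols[OF V(1) k])
  then have W: "W \<in> carrier_mat q k" by simp
  have colW: "col W j = col V (q - 1 - j)" if "j < k" for j
    using that k V(1) by (intro eq_vecI) (auto simp: W_eq)
  have Vo: "col V a \<bullet> col V b = (if a = b then 1 else 0)" if "a < q" "b < q" for a b
    using V that orthonormal_cols_iff[OF V(1)] by blast
  have "orthonormal_cols W"
    unfolding orthonormal_cols_iff[OF W] using k by (auto simp: colW Vo)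
  \<comment> \<open>The diagonal of \<open>D\<close> ascends, so its reversal is the descending list
    of eigenvalues; reversal does not change the product of the linear factors.\<close>
  define es where "es = rev (diag_mat D)"
  have es_nth: "es ! i = D $$ (q - 1 - i, q - 1 - i)" if "i < q" for i
    using that D(1) by (simp add: es_def diag_mat_def rev_nth)
  have "char_poly M = char_poly D"
    by (rule char_poly_similar, rule similar_matI[of _ _ V "V\<^sup>T" q])
      (use M V D MV orthonormal_colsD[OF V] in auto)
  also have "\<dots> = (\<Prod>e\<leftarrow>diag_mat D. [:- e, 1:])"
    by (rule char_poly_upper_triangular[OF D(1)]) (use D in \<open>auto simp: diagonal_mat_def upper_triangular_def\<close>)
  also have "\<dots> = (\<Prod>e\<leftarrow>es. [:- e, 1:])"
    unfolding es_def rev_map[symmetric] prod_mset_prod_list[symmetric] by simp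
  finally have "char_poly M = (\<Prod>e\<leftarrow>es. [:- e, 1:])" .
  moreover have "sorted_wrt (\<ge>) es"
    unfolding sorted_wrt_iff_nth_less
  proof (intro allI impI)
    fix i j assume "i < j" "j < length es"
    moreover have "length es = q" using D by (simp add: es_def diag_mat_def)
    ultimately show "es ! i \<ge> es ! j" by (auto simp: es_nth intro!: asc)
  qed
  moreover have "eigenvector M (col W j) (es ! j)" if "j < k" for j
  proof -
    have j: "j < q" "q - 1 - j < q" using that k by auto
    have "col V (q - 1 - j) \<noteq> 0\<^sub>v q" using Vo[OF j(2) j(2)] V(1) j by auto
    then show ?thesis
      unfolding eigenvector_def colW[OF that] es_nth[OF j(1)]
      using eig_eigenvector[OF E M j(2)] M V(1) j by auto
  qed
  ultimately show ?thesis
    unfolding leading_eigenvectors_def W_def[symmetric] using W \<open>orthonormal_cols W\<close> M by auto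
qed

text \<open>Converse of \<open>eig_leading_eigenvectors\<close>: every choice of leading
  eigenvectors, also inside a multiple eigenvalue, occurs in some ascending diagonalisation, because
  it extends to an eigenbasis that follows the same list \<open>es\<close>.\<close>

lemma leading_eigenvectors_extend_eig:
  assumes M: "M \<in> carrier_mat q q" "M\<^sup>T = M" and k: "k \<le> q" and "leading_eigenvectors M k W"
  obtains V D where "eig M V D" "rev_cols (submatrix V UNIV {q - k..<q}) = W"
proof -
  obtain es where W: "W \<in> carrier_mat q k" "orthonormal_cols W"
    and cp: "char_poly M = (\<Prod>e\<leftarrow>es. [:- e, 1:])" and sorted: "sorted_wrt (\<ge>) es"
    and ev: "\<And>j. j < k \<Longrightarrow> eigenvector M (col W j) (es ! j)"
    using assms by (auto simp: leading_eigenvectors_def)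
  have len: "length es = q" by (rule length_eigenvalues[OF M(1) cp])
  have fW: "a < k \<Longrightarrow> col W a \<in> carrier_vec q"
    "a < k \<Longrightarrow> b < k \<Longrightarrow> col W a \<bullet> col W b = (if a = b then 1 else 0)"
    "a < k \<Longrightarrow> M *\<^sub>v col W a = es ! a \<cdot>\<^sub>v col W a" for a b
    using W ev orthonormal_cols_iff[OF W(1)] by (auto simp: eigenvector_def)
  obtain g where gW: "\<And>a. a < k \<Longrightarrow> g a = col W a"
    and g: "\<And>a. a < q \<Longrightarrow> g a \<in> carrier_vec q" "\<And>a. a < q \<Longrightarrow> M *\<^sub>v g a = es ! a \<cdot>\<^sub>v g a"
    and go: "\<And>a b. a < q \<Longrightarrow> b < q \<Longrightarrow> g a \<bullet> g b = (if a = b then 1 else 0)"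
    using eigenbasis_extend[OF M cp fW k] by blast
  \<comment> \<open>Reversing the basis makes the eigenvalues ascend and moves the columns of
    \<open>W\<close>, in reverse order, to the last \<open>k\<close> positions.\<close>
  define V where "V = mat_of_fun_cols q q (\<lambda>a. g (q - 1 - a))"
  define D where "D = mat_diag q (\<lambda>a. es ! (q - 1 - a))"
  have V: "V \<in> carrier_mat q q" and colV: "a < q \<Longrightarrow> col V a = g (q - 1 - a)" for a
    using g(1) by (auto simp: V_def mat_of_fun_cols)
  have D: "D \<in> carrier_mat q q" by (simp add: D_def)
  have Vo: "orthonormal_cols V"
    unfolding orthonormal_cols_iff[OF V] using go by (auto simp: colV)
  have "M * V = V * D"
  proof (rule eq_matI)
    fix i a assume "i < dim_row (V * D)" "a < dim_col (V * D)"
    then have ia: "i < q" "a < q" using V D by auto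
    have "(M * V) $$ (i, a) = (M *\<^sub>v col V a) $ i" using ia M V by simp
    also have "\<dots> = es ! (q - 1 - a) * g (q - 1 - a) $ i"
      using ia g(1)[of "q - 1 - a"] g(2)[of "q - 1 - a"] by (simp add: colV)
    also have "g (q - 1 - a) $ i = V $$ (i, a)" using ia by (simp add: V_def mat_of_fun_cols_def)
    also have "es ! (q - 1 - a) * V $$ (i, a) = (V * D) $$ (i, a)"
      unfolding D_def using ia V by (simp add: mat_diag_mult_right[of _ q] mult.commute)
    finally show "(M * V) $$ (i, a) = (V * D) $$ (i, a)" .
  qed (use M V D in auto)
  then have "M * (V * V\<^sup>T) = V * D * V\<^sup>T" using M V assoc_mult_mat[of M q q V q "V\<^sup>T" q] by simp
  then have "M = V * D * V\<^sup>T" using orthonormal_colsD[OF V Vo] M by simp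
  moreover have "D $$ (i, i) \<le> D $$ (j, j)" if "j < q" "i \<le> j" for i j
  proof (cases "i = j")
    case False
    then have "q - 1 - j < q - 1 - i" "q - 1 - i < length es" using that len by auto
    with sorted have "es ! (q - 1 - j) \<ge> es ! (q - 1 - i)" by (simp add: sorted_wrt_iff_nth_less)
    then show ?thesis using that by (simp add: D_def mat_diag_def)
  qed simp
  moreover have "diagonal_mat D" by (auto simp: D_def mat_diag_def diagonal_mat_def)
  ultimately have "eig M V D" using V Vo D M by (auto simp: eig_def Let_def)
  moreover have "rev_cols (submatrix V UNIV {q - k..<q}) = W"
    unfolding rev_cols_submatrix_last_cols[OF V k]
    using k gW W(1) by (intro eq_matI) (auto simp: V_def mat_of_fun_cols_def)
  ultimately show ?thesis by (rule that)
qed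

section \<open>The block Krylov matrix\<close>

text \<open>The squared norm of \<open>A w\<close> is the scalar product of
  \<open>A\<^sup>T A w\<close> with \<open>w\<close>.\<close>

lemma transpose_mult_mat_vec_eq_0:
  fixes A :: "real mat"
  assumes A: "A \<in> carrier_mat m n" and w: "w \<in> carrier_vec n" and "A\<^sup>T *\<^sub>v (A *\<^sub>v w) = 0\<^sub>v n"
  shows "A *\<^sub>v w = 0\<^sub>v m"
proof (rule ccontr)
  have Aw: "A *\<^sub>v w \<in> carrier_vec m" using A w by simp
  assume "A *\<^sub>v w \<noteq> 0\<^sub>v m"
  from scalar_prod_self_pos[OF Aw this] have "(A *\<^sub>v w) \<bullet> (A *\<^sub>v w) > 0" .
  moreover have "(A\<^sup>T *\<^sub>v (A *\<^sub>v w)) \<bullet> w = (A *\<^sub>v w) \<bullet> (A *\<^sub>v w)"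
    using transpose_vec_mult_scalar[OF A w Aw] by simp
  ultimately show False using assms(3) w by simp
qed

lemma hcat_mult_left:
  assumes A: "A \<in> carrier_mat m n" and G: "\<And>i. i < t \<Longrightarrow> G i \<in> carrier_mat n r"
  shows "hcat m (map (\<lambda>i. A * G i) [0..<t]) = A * hcat n (map G [0..<t])"
proof (rule eq_matI)
  have AG: "\<And>i. i < t \<Longrightarrow> A * G i \<in> carrier_mat m r" using A G by (metis mult_carrier_mat)
  note hG = hcat_carrier[of t G, OF G] and hAG = hcat_carrier[of t "\<lambda>i. A * G i", OF AG]
  show "dim_row (hcat m (map (\<lambda>i. A * G i) [0..<t])) = dim_row (A * hcat n (map G [0..<t]))"
    "dim_col (hcat m (map (\<lambda>i. A * G i) [0..<t])) = dim_col (A * hcat n (map G [0..<t]))"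
    using A hG hAG by auto
  fix a c assume "a < dim_row (A * hcat n (map G [0..<t]))" "c < dim_col (A * hcat n (map G [0..<t]))"
  then have a: "a < m" and c: "c < t * r" using A hG by auto
  have r: "0 < r" using c by (cases r) auto
  have cd: "c mod r < r" "c div r < t" using c r by (auto simp: less_mult_imp_div_less)
  have "hcat m (map (\<lambda>i. A * G i) [0..<t]) $$ (a, c) = (A * G (c div r)) $$ (a, c mod r)"
    by (rule hcat_index[of t "\<lambda>i. A * G i", OF AG a c])
  also have "\<dots> = (\<Sum>x = 0..<n. A $$ (a, x) * G (c div r) $$ (x, c mod r))"
    using A a cd G[OF cd(2)] by (simp add: scalar_prod_def)
  also have "\<dots> = (\<Sum>x = 0..<n. A $$ (a, x) * hcat n (map G [0..<t]) $$ (x, c))"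
    using hcat_index[of t G, OF G _ c] by simp
  also have "\<dots> = (A * hcat n (map G [0..<t])) $$ (a, c)"
    using A a c hG by (simp add: scalar_prod_def)
  finally show "hcat m (map (\<lambda>i. A * G i) [0..<t]) $$ (a, c) = (A * hcat n (map G [0..<t])) $$ (a, c)" .
qed

text \<open>The library power appends its factor on the right, while the Krylov recursion adds one
  on the left.\<close>

lemma pow_mat_Suc_left:
  assumes G: "G \<in> carrier_mat m m"
  shows "G ^\<^sub>m Suc i = G * G ^\<^sub>m i"
proof (induction i)
  case 0
  then show ?case using G by simp
next
  case (Suc i)
  have "G ^\<^sub>m Suc (Suc i) = G * G ^\<^sub>m i * G" using Suc by simp
  also have "\<dots> = G * (G ^\<^sub>m i * G)" using G by (intro assoc_mult_mat) auto
  finally show ?case by simp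
qed

lemma mult_mat_inverse:
  fixes R :: "real mat"
  assumes c: "R \<in> carrier_mat r r" "R' \<in> carrier_mat r r" "T \<in> carrier_mat r r" "T' \<in> carrier_mat r r"
    and "R * R' = 1\<^sub>m r" "T * T' = 1\<^sub>m r"
  shows "R * T * (T' * R') = 1\<^sub>m r"
proof -
  have "R * T * (T' * R') = R * T * T' * R'"
    using c by (intro assoc_mult_mat[symmetric]) auto
  also have "R * T * T' = R * (T * T')" by (rule assoc_mult_mat[OF c(1,3,4)])
  finally show ?thesis using assms by simp
qed

section \<open>Krylov blocks and their range\<close>

definition krylov_block :: "real mat \<Rightarrow> real mat \<Rightarrow> nat \<Rightarrow> real mat" where
  "krylov_block A \<Omega> i = (A * A\<^sup>T) ^\<^sub>m i * A * \<Omega>"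

lemma krylov_eq: "krylov A \<Omega> p = hcat (dim_row A) (map (krylov_block A \<Omega>) [0..<Suc p])"
  by (simp add: krylov_def krylov_block_def[abs_def])

context
  fixes A \<Omega> :: "real mat" and m n r :: nat
  assumes A: "A \<in> carrier_mat m n" and \<Omega>: "\<Omega> \<in> carrier_mat n r"
begin

lemma gram_carrier: "A * A\<^sup>T \<in> carrier_mat m m" "A\<^sup>T \<in> carrier_mat n m"
  using A by auto

lemma krylov_block_carrier: "krylov_block A \<Omega> i \<in> carrier_mat m r"
  using A \<Omega> by (auto simp: krylov_block_def)

lemma krylov_carrier: "krylov A \<Omega> p \<in> carrier_mat m (Suc p * r)"
  unfolding krylov_eq using hcat_carrier[of "Suc p" "krylov_block A \<Omega>", OF krylov_block_carrier] A
  by simp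

lemma krylov_block_0: "krylov_block A \<Omega> 0 = A * \<Omega>"
  using A by (simp add: krylov_block_def)

text \<open>The bracketing matches the argument that rSVD-BKI passes to its LU steps.\<close>

lemma krylov_block_Suc: "krylov_block A \<Omega> (Suc i) = A * (A\<^sup>T * krylov_block A \<Omega> i)"
proof -
  note G = pow_carrier_mat[OF gram_carrier(1), of i]
  have GA: "(A * A\<^sup>T) ^\<^sub>m i * A \<in> carrier_mat m n" using G A by auto
  have "krylov_block A \<Omega> (Suc i) = A * A\<^sup>T * (A * A\<^sup>T) ^\<^sub>m i * A * \<Omega>"
    unfolding krylov_block_def pow_mat_Suc_left[OF gram_carrier(1)] ..
  also have "\<dots> = A * A\<^sup>T * ((A * A\<^sup>T) ^\<^sub>m i * A) * \<Omega>"
    using assoc_mult_mat[OF gram_carrier(1) G A] by simp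
  also have "\<dots> = A * A\<^sup>T * krylov_block A \<Omega> i"
    unfolding krylov_block_def by (rule assoc_mult_mat[OF gram_carrier(1) GA \<Omega>])
  also have "\<dots> = A * (A\<^sup>T * krylov_block A \<Omega> i)"
    by (rule assoc_mult_mat[OF A gram_carrier(2) krylov_block_carrier])
  finally show ?thesis .
qed

lemma krylov_block_range: "\<exists>G \<in> carrier_mat n r. krylov_block A \<Omega> i = A * G"
proof (cases i)
  case 0
  then show ?thesis using \<Omega> krylov_block_0 by auto
next
  case (Suc j)
  have "A\<^sup>T * krylov_block A \<Omega> j \<in> carrier_mat n r"
    using gram_carrier(2) krylov_block_carrier by (rule mult_carrier_mat)
  then show ?thesis using krylov_block_Suc Suc by blast
qed

lemma krylov_range:
  obtains N where "N \<in> carrier_mat n (Suc p * r)" "krylov A \<Omega> p = A * N"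
proof -
  obtain G where G: "\<And>i. G i \<in> carrier_mat n r" "\<And>i. krylov_block A \<Omega> i = A * G i"
    using krylov_block_range by metis
  have "krylov_block A \<Omega> = (\<lambda>i. A * G i)" using G(2) by blast
  then have "krylov A \<Omega> p = A * hcat n (map G [0..<Suc p])"
    unfolding krylov_eq carrier_matD(1)[OF A] using hcat_mult_left[OF A, of "Suc p" G r] G(1) by metis
  then show ?thesis using that[OF hcat_carrier] G(1) by blast
qed

text \<open>Suppose \<open>A\<^sup>T Q v = 0\<close>. The columns of \<open>Q\<close> span the
  Krylov space, which lies in the range of \<open>A\<close>, so \<open>Q v = A w\<close> for some
  \<open>w\<close>. Then \<open>A\<^sup>T A w = 0\<close> forces \<open>Q v = 0\<close>, and
  orthonormality gives \<open>v = 0\<close>.\<close>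

lemma full_col_rank_projected:
  assumes Q: "orth (krylov A \<Omega> p) Q"
  shows "full_col_rank ((Q\<^sup>T * A)\<^sup>T)"
proof -
  define q where "q = Suc p * r"
  have Qc: "Q \<in> carrier_mat m q" and Qo: "orthonormal_cols Q"
    and cs: "vec_space.col_space m Q = vec_space.col_space m (krylov A \<Omega> p)"
    using Q krylov_carrier[of p] by (auto simp: orth_def q_def)
  have C: "(Q\<^sup>T * A)\<^sup>T = A\<^sup>T * Q" using transpose_mult[of "Q\<^sup>T" q m A n] Qc A by simp
  obtain N where N: "N \<in> carrier_mat n q" "krylov A \<Omega> p = A * N"
    unfolding q_def by (rule krylov_range)
  interpret vec_space "TYPE(real)" m .
  show ?thesis
    unfolding C
  proof (rule full_col_rankI)
    show "A\<^sup>T * Q \<in> carrier_mat n q" using A Qc by auto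
    fix v :: "real vec" assume v: "v \<in> carrier_vec q" "A\<^sup>T * Q *\<^sub>v v = 0\<^sub>v n"
    have "Q *\<^sub>v v \<in> col_space (krylov A \<Omega> p)"
      unfolding cs[symmetric] col_space_eq[OF Qc] using v(1) Qc by auto
    then obtain y where y: "y \<in> carrier_vec q" "Q *\<^sub>v v = krylov A \<Omega> p *\<^sub>v y"
      unfolding col_space_eq[OF krylov_carrier] using krylov_carrier[of p] by (auto simp: q_def)
    have Qv: "Q *\<^sub>v v = A *\<^sub>v (N *\<^sub>v y)" unfolding y N(2) using A N y by (simp add: assoc_mult_mat_vec)
    have "A\<^sup>T *\<^sub>v (A *\<^sub>v (N *\<^sub>v y)) = 0\<^sub>v n"
      unfolding Qv[symmetric] using v assoc_mult_mat_vec[OF gram_carrier(2) Qc v(1)] by simp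
    then have "Q *\<^sub>v v = 0\<^sub>v m"
      unfolding Qv using transpose_mult_mat_vec_eq_0[OF A] N y by simp
    then have "Q\<^sup>T *\<^sub>v (Q *\<^sub>v v) = 0\<^sub>v q" using Qc by auto
    moreover have "Q\<^sup>T *\<^sub>v (Q *\<^sub>v v) = Q\<^sup>T * Q *\<^sub>v v"
      using Qc v(1) by (intro assoc_mult_mat_vec[symmetric]) auto
    moreover have "Q\<^sup>T * Q *\<^sub>v v = v" using Qc Qo v(1) by (simp add: orthonormal_cols_def)
    ultimately show "v = 0\<^sub>v q" by simp
  qed
qed

text \<open>Each LU step contributes one more invertible factor on the right. \<open>R * R'\<close>
  serves to recover the Krylov block from \<open>H i\<close>, and \<open>R' * R\<close> to transfer
  full column rank.\<close>

lemma lu_blocks_column_equivalent: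
  assumes "lu_fst (A * \<Omega>) (H 0)" "\<forall>i\<in>{1..p}. lu_fst (A * (A\<^sup>T * H (i - 1))) (H i)"
  shows "i \<le> p \<Longrightarrow> \<exists>R R'. R \<in> carrier_mat r r \<and> R' \<in> carrier_mat r r \<and> R * R' = 1\<^sub>m r \<and> R' * R = 1\<^sub>m r
    \<and> H i = krylov_block A \<Omega> i * R"
proof (induction i)
  case 0
  have "A * \<Omega> \<in> carrier_mat m r" using A \<Omega> by auto
  from lu_fst_column_equivalent[OF assms(1) this] show ?case unfolding krylov_block_0 by metis
next
  case (Suc i)
  then obtain R R' where R: "R \<in> carrier_mat r r" "R' \<in> carrier_mat r r" "R * R' = 1\<^sub>m r" "R' * R = 1\<^sub>m r"
    and Hi: "H i = krylov_block A \<Omega> i * R" by auto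
  note K = krylov_block_carrier
  have AH: "A * (A\<^sup>T * H i) = krylov_block A \<Omega> (Suc i) * R"
    unfolding krylov_block_Suc Hi using assoc_mult_mat[OF gram_carrier(2) K R(1)]
      assoc_mult_mat[OF A mult_carrier_mat[OF gram_carrier(2) K] R(1)] by simp
  have "lu_fst (krylov_block A \<Omega> (Suc i) * R) (H (Suc i))"
    using assms(2) Suc.prems AH by (metis atLeastAtMost_iff diff_Suc_1 le_add1 plus_1_eq_Suc)
  moreover have "krylov_block A \<Omega> (Suc i) * R \<in> carrier_mat m r" using K R(1) by (rule mult_carrier_mat)
  ultimately obtain T T' where T: "T \<in> carrier_mat r r" "T' \<in> carrier_mat r r" "T * T' = 1\<^sub>m r" "T' * T = 1\<^sub>m r"
    and H: "H (Suc i) = krylov_block A \<Omega> (Suc i) * R * T"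
    by (rule lu_fst_column_equivalent)
  note mult_mat_inverse[OF R(1,2) T(1,2) R(3) T(3)] mult_mat_inverse[OF T(2,1) R(2,1) T(4) R(4)]
  moreover have "H (Suc i) = krylov_block A \<Omega> (Suc i) * (R * T)"
    unfolding H by (rule assoc_mult_mat[OF K R(1) T(1)])
  ultimately show ?case
    using R T by (intro exI[of _ "R * T"] exI[of _ "T' * R'"]) auto
qed

text \<open>The two concatenations arise from each other by blockwise right multiplication, so their
  column spaces agree, and \<open>orth\<close> depends on nothing else besides the size.\<close>

lemma lu_blocks_orth_iff:
  assumes "lu_fst (A * \<Omega>) (H 0)" "\<forall>i\<in>{1..p}. lu_fst (A * (A\<^sup>T * H (i - 1))) (H i)"
  shows "orth (hcat m (map H [0..<Suc p])) Q \<longleftrightarrow> orth (krylov A \<Omega> p) Q"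
proof -
  note K = krylov_block_carrier
  have "\<forall>i. \<exists>R R'. i < Suc p \<longrightarrow> R \<in> carrier_mat r r \<and> R' \<in> carrier_mat r r \<and> R * R' = 1\<^sub>m r \<and> R' * R = 1\<^sub>m r
    \<and> H i = krylov_block A \<Omega> i * R"
    using lu_blocks_column_equivalent[OF assms] by (meson less_Suc_eq_le)
  then obtain R R' where R: "\<And>i. i < Suc p \<Longrightarrow> R i \<in> carrier_mat r r" "\<And>i. i < Suc p \<Longrightarrow> R' i \<in> carrier_mat r r"
    "\<And>i. i < Suc p \<Longrightarrow> R i * R' i = 1\<^sub>m r" "\<And>i. i < Suc p \<Longrightarrow> H i = krylov_block A \<Omega> i * R i"
    by metis
  have H: "H i \<in> carrier_mat m r" if "i < Suc p" for i
    unfolding R(4)[OF that] using K R(1)[OF that] by (rule mult_carrier_mat)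
  have HR: "H i * R' i = krylov_block A \<Omega> i" if "i < Suc p" for i
    unfolding R(4)[OF that] assoc_mult_mat[OF K R(1,2)[OF that]] R(3)[OF that]
    using K by (rule right_mult_one_mat)
  have "krylov A \<Omega> p = hcat m (map (\<lambda>i. H i * R' i) [0..<Suc p])"
    unfolding krylov_eq carrier_matD(1)[OF A]
    by (rule arg_cong[of _ _ "hcat m"], rule map_cong) (use HR in auto)
  moreover have "hcat m (map H [0..<Suc p]) = hcat m (map (\<lambda>i. krylov_block A \<Omega> i * R i) [0..<Suc p])"
    by (rule arg_cong[of _ _ "hcat m"], rule map_cong) (use R(4) in auto)
  moreover have "krylov A \<Omega> p = hcat m (map (krylov_block A \<Omega>) [0..<Suc p])"
    unfolding krylov_eq using A by simp
  ultimately have "vec_space.col_space m (hcat m (map H [0..<Suc p])) = vec_space.col_space m (krylov A \<Omega> p)"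
    using hcat_col_space_subset[of "Suc p" H m r R', OF H R(2)]
      hcat_col_space_subset[of "Suc p" "krylov_block A \<Omega>" m r R, OF K R(1)]
    by (metis subset_antisym)
  then show ?thesis
    using orth_cong[OF hcat_carrier[of "Suc p" H, OF H] krylov_carrier] by blast
qed

lemma lu_blocks_exist:
  assumes "full_col_rank (krylov A \<Omega> p)"
  obtains H where "lu_fst (A * \<Omega>) (H 0)" "\<forall>i\<in>{1..p}. lu_fst (A * (A\<^sup>T * H (i - 1))) (H i)"
proof -
  have rk: "full_col_rank (krylov_block A \<Omega> i)" if "i \<le> p" for i
  proof (rule hcat_block_full_col_rank)
    show "krylov_block A \<Omega> j \<in> carrier_mat m r" for j by (rule krylov_block_carrier)
    show "full_col_rank (hcat m (map (krylov_block A \<Omega>) [0..<Suc p]))"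
      using assms A unfolding krylov_eq by simp
  qed (use that in simp)
  \<comment> \<open>Each block is an arbitrary LU output for its predecessor. That such an output
    exists is known only once the earlier steps are valid, hence the induction on the length
    \<open>j\<close> of the valid prefix.\<close>
  define H where "H = rec_nat (SOME W. lu_fst (A * \<Omega>) W) (\<lambda>_ X. SOME W. lu_fst (A * (A\<^sup>T * X)) W)"
  have H0: "lu_fst (A * \<Omega>) (H 0)"
    using someI_ex[OF lu_fst_exists[OF rk[of 0, unfolded krylov_block_0]]] by (simp add: H_def)
  have "j \<le> p \<Longrightarrow> \<forall>i\<in>{1..j}. lu_fst (A * (A\<^sup>T * H (i - 1))) (H i)" for j
  proof (induction j)
    case (Suc j)
    then have IH: "\<forall>i\<in>{1..j}. lu_fst (A * (A\<^sup>T * H (i - 1))) (H i)" by simp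
    obtain R R' where R: "R \<in> carrier_mat r r" "R' \<in> carrier_mat r r" "R' * R = 1\<^sub>m r"
      and Hj: "H j = krylov_block A \<Omega> j * R"
      using lu_blocks_column_equivalent[OF H0 IH order_refl] by blast
    have "A * (A\<^sup>T * H j) = krylov_block A \<Omega> (Suc j) * R"
      unfolding krylov_block_Suc Hj
      using assoc_mult_mat[OF gram_carrier(2) krylov_block_carrier R(1)]
        assoc_mult_mat[OF A mult_carrier_mat[OF gram_carrier(2) krylov_block_carrier] R(1)] by simp
    then have "full_col_rank (A * (A\<^sup>T * H j))"
      using full_col_rank_mult_invertible[OF krylov_block_carrier rk[OF Suc.prems] R] by simp
    then have "lu_fst (A * (A\<^sup>T * H j)) (H (Suc j))"
      using someI_ex[OF lu_fst_exists] by (simp add: H_def)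
    with IH show ?case by (auto simp: le_Suc_eq)
  qed simp
  with H0 that show ?thesis by blast
qed

end

section \<open>The two algorithms\<close>

text \<open>Off-diagonal entries remain zero because \<open>sqrt 0 = 0\<close>.\<close>

lemma eig_diagonal_eq:
  assumes "eig M V D" "M \<in> carrier_mat q q"
  shows "map_mat sqrt D = mat_diag q (\<lambda>i. sqrt (D $$ (i, i)))"
  using assms by (intro eq_matI) (auto simp: eig_def Let_def mat_diag_def diagonal_mat_def)

text \<open>Undoing the inverse of \<open>S\<close> gives \<open>V S = C U\<close>. As
  \<open>S\<close> is diagonal, each column of \<open>V S\<close> involves only the same column of
  \<open>V\<close>, so the identity restricts to the last \<open>k\<close> columns.\<close>

lemma eigSVD_truncated_product:
  assumes C: "C \<in> carrier_mat n q" and E: "eigSVD C V S U" and k: "k \<le> q"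
    and D: "eig (C\<^sup>T * C) U D" "S = map_mat sqrt D"
  shows "submatrix V UNIV {q - k..<q} * submatrix S {q - k..<q} {q - k..<q} = C * submatrix U UNIV {q - k..<q}"
proof -
  have M: "C\<^sup>T * C \<in> carrier_mat q q" using C by auto
  have S: "S = mat_diag q (\<lambda>i. sqrt (D $$ (i, i)))" using eig_diagonal_eq[OF D(1) M] D(2) by simp
  have Sc: "S \<in> carrier_mat q q" by (simp add: S)
  have U: "U \<in> carrier_mat q q" using D(1) C by (auto simp: eig_def Let_def)
  obtain T where T: "T \<in> carrier_mat q q" "T * S = 1\<^sub>m q" "V = C * U * T"
    using E C by (auto simp: eigSVD_def inverts_mat_def)
  have CU: "C * U \<in> carrier_mat n q" using C U by auto
  have V: "V \<in> carrier_mat n q" using CU T by auto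
  have VS: "V * S = C * U"
    unfolding T(3) assoc_mult_mat[OF CU T(1) Sc] T(2) using CU by (rule right_mult_one_mat)
  have VS_index: "(V * S) $$ (i, j) = V $$ (i, j) * sqrt (D $$ (j, j))" if "i < n" "j < q" for i j
    unfolding S using that V by (simp add: mat_diag_mult_right[of _ n])
  have S_ind: "submatrix S {q - k..<q} {q - k..<q} = mat_diag k (\<lambda>j. sqrt (D $$ (q - k + j, q - k + j)))"
    unfolding submatrix_last_block[OF Sc k] using k
    by (intro eq_matI) (auto simp: S mat_diag_def)
  have "submatrix V UNIV {q - k..<q} * submatrix S {q - k..<q} {q - k..<q}
      = mat n k (\<lambda>(i, j). (V * S) $$ (i, q - k + j))"
    unfolding submatrix_last_cols[OF V k] S_ind using k
    by (subst mat_diag_mult_right[of _ n]) (auto simp: VS_index intro!: eq_matI)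
  also have "\<dots> = C * submatrix U UNIV {q - k..<q}"
    unfolding VS submatrix_last_cols[OF U k] using C U k
    by (intro eq_matI) (auto simp: scalar_prod_def)
  finally show ?thesis .
qed

lemma eigSVD_exists:
  assumes C: "C \<in> carrier_mat n q" and rk: "full_col_rank C" and D: "eig (C\<^sup>T * C) U D"
  obtains V S where "eigSVD C V S U"
proof -
  have M: "C\<^sup>T * C \<in> carrier_mat q q" using C by auto
  have U: "U \<in> carrier_mat q q" "orthonormal_cols U" using D C by (auto simp: eig_def Let_def)
  \<comment> \<open>A zero eigenvalue would put a column of \<open>U\<close>, a unit vector, into
    the kernel of \<open>C\<close>.\<close>
  have D0: "D $$ (a, a) \<noteq> 0" if a: "a < q" for a
  proof
    assume "D $$ (a, a) = 0"
    have u: "col U a \<in> carrier_vec q" using U a by auto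
    have "C\<^sup>T * C *\<^sub>v col U a = 0\<^sub>v q"
      using eig_eigenvector[OF D M a] \<open>D $$ (a, a) = 0\<close> u U(1) by (auto intro!: eq_vecI)
    then have "C\<^sup>T *\<^sub>v (C *\<^sub>v col U a) = 0\<^sub>v q"
      using assoc_mult_mat_vec[of "C\<^sup>T" q n C q "col U a"] C u by simp
    then have "col U a = 0\<^sub>v q"
      using full_col_rankD[OF rk C u] transpose_mult_mat_vec_eq_0[OF C u] by blast
    moreover have "col U a \<bullet> col U a = 1" using orthonormal_cols_iff[OF U(1)] U(2) a by auto
    ultimately show False by simp
  qed
  define S where "S = map_mat sqrt D"
  have S: "S = mat_diag q (\<lambda>i. sqrt (D $$ (i, i)))" using eig_diagonal_eq[OF D M] by (simp add: S_def)
  define T where "T = mat_diag q (\<lambda>i. 1 / sqrt (D $$ (i, i)))"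
  have T: "T \<in> carrier_mat q q" by (simp add: T_def)
  \<comment> \<open>Nonzero diagonal entries are enough here, since the real \<open>sqrt\<close>
    vanishes only at 0.\<close>
  have "S * T = mat_diag q (\<lambda>i. 1)" "T * S = mat_diag q (\<lambda>i. 1)"
    unfolding S T_def mat_diag_diag using D0 by (auto simp: mat_diag_def intro!: eq_matI)
  then have "inverts_mat S T" "inverts_mat T S"
    using T by (auto simp: inverts_mat_def S mat_diag_def)
  then have "eigSVD C (C * U * T) S U"
    unfolding eigSVD_def using C rk D T full_col_rank_le[OF C rk] S_def by auto
  then show ?thesis by (rule that)
qed

text \<open>Symmetry of \<open>S\<close> gives \<open>S V\<^sup>T = (V S)\<^sup>T\<close>, and the
  hypothesis on \<open>V S\<close> turns this into \<open>(Q X)\<^sup>T A\<close>.\<close>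

lemma truncated_projection_product:
  assumes A: "A \<in> carrier_mat m n" and Q: "Q \<in> carrier_mat m q" and X: "X \<in> carrier_mat q k"
    and V: "V \<in> carrier_mat n k" and S: "S \<in> carrier_mat k k" "S\<^sup>T = S"
    and VS: "V * S = (Q\<^sup>T * A)\<^sup>T * X"
  shows "Q * X * S * V\<^sup>T = Q * X * (Q * X)\<^sup>T * (A :: real mat)"
proof -
  have QX: "Q * X \<in> carrier_mat m k" using Q X by auto
  have "S * V\<^sup>T = (V * S)\<^sup>T" using transpose_mult[OF V S(1)] S by simp
  also have "\<dots> = X\<^sup>T * (Q\<^sup>T * A)"
    unfolding VS using transpose_mult[of "(Q\<^sup>T * A)\<^sup>T" n q X k] Q A X by simp
  also have "\<dots> = (Q * X)\<^sup>T * A"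
    unfolding transpose_mult[OF Q X] using Q A X by (intro assoc_mult_mat[symmetric]) auto
  finally have SV: "S * V\<^sup>T = (Q * X)\<^sup>T * A" .
  have "Q * X * S * V\<^sup>T = Q * X * (S * V\<^sup>T)" using QX S V by (intro assoc_mult_mat) auto
  also have "\<dots> = Q * X * (Q * X)\<^sup>T * A"
    unfolding SV using QX A by (intro assoc_mult_mat[symmetric]) auto
  finally show ?thesis .
qed

theorem theorem2:
  fixes A \<Omega> :: "real mat" and m n k s p :: nat
  assumes "A \<in> carrier_mat m n"
    and "k \<ge> 1"
    and "\<Omega> \<in> carrier_mat n (k + s)"
    and "full_col_rank (krylov A \<Omega> p)"
  shows "(\<lambda>(X, Y). (rev_cols X, Y)) ` {(U, U * S * V\<^sup>T) | U S V. rSVD_BKI A \<Omega> k s p U S V}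
       = {(Z, Z * Z\<^sup>T * A) | Z. BKI A \<Omega> k s p Z}"
proof -
  note A = assms(1) and \<Omega> = assms(3) and rk = assms(4)
  define q where "q = (k + s) * (p + 1)"
  \<comment> \<open>These are the 0-based positions of the last \<open>k\<close> of the
    \<open>q\<close> columns.\<close>
  define ind where "ind = {q - k..<q}"
  have k: "k \<le> q" by (simp add: q_def)
  have gram: "(Q\<^sup>T * A)\<^sup>T\<^sup>T * (Q\<^sup>T * A)\<^sup>T = Q\<^sup>T * A * A\<^sup>T * Q"
    and C: "(Q\<^sup>T * A)\<^sup>T \<in> carrier_mat n q"
    and rkC: "full_col_rank ((Q\<^sup>T * A)\<^sup>T)"
    and Q: "Q \<in> carrier_mat m q"
    if "orth (krylov A \<Omega> p) Q" for Q
  proof -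
    show Q: "Q \<in> carrier_mat m q"
      using that krylov_carrier[OF A \<Omega>, of p] by (simp add: orth_def q_def mult.commute)
    show "(Q\<^sup>T * A)\<^sup>T \<in> carrier_mat n q" using Q A by auto
    show "full_col_rank ((Q\<^sup>T * A)\<^sup>T)" by (rule full_col_rank_projected[OF A \<Omega> that])
    have B: "Q\<^sup>T * A \<in> carrier_mat q n" using Q A by auto
    have "(Q\<^sup>T * A)\<^sup>T = A\<^sup>T * Q" using transpose_mult[of "Q\<^sup>T" q m A n] Q A by simp
    then have "(Q\<^sup>T * A)\<^sup>T\<^sup>T * (Q\<^sup>T * A)\<^sup>T = Q\<^sup>T * A * (A\<^sup>T * Q)"
      unfolding transpose_transpose by (rule arg_cong)
    also have "\<dots> = Q\<^sup>T * A * A\<^sup>T * Q" using B A Q by (intro assoc_mult_mat[symmetric]) auto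
    finally show "(Q\<^sup>T * A)\<^sup>T\<^sup>T * (Q\<^sup>T * A)\<^sup>T = Q\<^sup>T * A * A\<^sup>T * Q" .
  qed
  \<comment> \<open>Both inclusions rest on this comparison: for a common \<open>Q\<close> and a
    common orthogonal factor \<open>U'\<close>, the outputs of the two algorithms
    correspond.\<close>
  have outputs: "Z = rev_cols U \<and> U * S * V\<^sup>T = Z * Z\<^sup>T * A"
    if o: "orth (krylov A \<Omega> p) Q" and E: "eigSVD (Q\<^sup>T * A)\<^sup>T V' S' U'"
      and U: "U = Q * submatrix U' UNIV ind" and S: "S = submatrix S' ind ind"
      and V: "V = submatrix V' UNIV ind" and Z: "Z = Q * rev_cols (submatrix U' UNIV ind)"
    for Q U' S' V' U S V Z
  proof -
    note C = C[OF o] and Q = Q[OF o]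
    obtain D where D: "eig ((Q\<^sup>T * A)\<^sup>T\<^sup>T * (Q\<^sup>T * A)\<^sup>T) U' D" "S' = map_mat sqrt D"
      using E by (auto simp: eigSVD_def)
    have M: "(Q\<^sup>T * A)\<^sup>T\<^sup>T * (Q\<^sup>T * A)\<^sup>T \<in> carrier_mat q q" using C by auto
    have S'_eq: "S' = mat_diag q (\<lambda>i. sqrt (D $$ (i, i)))" using eig_diagonal_eq[OF D(1) M] D(2) by simp
    then have S'c: "S' \<in> carrier_mat q q" by simp
    have U': "U' \<in> carrier_mat q q" using D(1) C by (auto simp: eig_def Let_def)
    obtain T where T: "T \<in> carrier_mat q q" "V' = (Q\<^sup>T * A)\<^sup>T * U' * T"
      using E unfolding eigSVD_def carrier_matD(2)[OF C] by blast
    have V': "V' \<in> carrier_mat n q"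
      unfolding T(2) by (rule mult_carrier_mat[OF mult_carrier_mat[OF C U'] T(1)])
    have X: "submatrix U' UNIV ind \<in> carrier_mat q k" and Vc: "V \<in> carrier_mat n k" and Sc: "S \<in> carrier_mat k k"
      unfolding V S ind_def submatrix_last_cols[OF U' k] submatrix_last_cols[OF V' k] submatrix_last_block[OF S'c k]
      by auto
    have "S\<^sup>T = S"
      unfolding S ind_def submatrix_last_block[OF S'c k] using k
      by (intro eq_matI) (auto simp: S'_eq mat_diag_def)
    moreover have "V * S = (Q\<^sup>T * A)\<^sup>T * submatrix U' UNIV ind"
      unfolding V S ind_def by (rule eigSVD_truncated_product[OF C E k D])
    ultimately have "U * S * V\<^sup>T = U * U\<^sup>T * A"
      unfolding U by (intro truncated_projection_product[OF A Q X Vc Sc])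
    moreover have "Z = rev_cols U" unfolding Z U by (rule rev_cols_mult[OF Q X, symmetric])
    moreover have "U \<in> carrier_mat m k" unfolding U using Q X by (rule mult_carrier_mat)
    ultimately show ?thesis by (simp add: rev_cols_gram)
  qed
  show ?thesis
  proof (intro equalityI subsetI)
    fix P assume "P \<in> (\<lambda>(X, Y). (rev_cols X, Y)) ` {(U, U * S * V\<^sup>T) | U S V. rSVD_BKI A \<Omega> k s p U S V}"
    then obtain U S V where P: "P = (rev_cols U, U * S * V\<^sup>T)" and "rSVD_BKI A \<Omega> k s p U S V" by auto
    then obtain H Q V' S' U' where H: "lu_fst (A * \<Omega>) (H 0)" "\<forall>i\<in>{1..p}. lu_fst (A * (A\<^sup>T * H (i - 1))) (H i)"
      and oH: "orth (hcat m (map H [0..<Suc p])) Q" and E: "eigSVD (Q\<^sup>T * A)\<^sup>T V' S' U'"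
      and USV: "U = Q * submatrix U' UNIV ind" "S = submatrix S' ind ind" "V = submatrix V' UNIV ind"
      using A unfolding rSVD_BKI_def Let_def ind_def q_def by (auto simp del: upt_Suc)
    have o: "orth (krylov A \<Omega> p) Q" using lu_blocks_orth_iff[OF A \<Omega> H] oH by simp
    obtain D where D: "eig (Q\<^sup>T * A * A\<^sup>T * Q) U' D"
      using E unfolding eigSVD_def gram[OF o] by blast
    \<comment> \<open>The reversed trailing columns of \<open>U'\<close> are an admissible choice in
      BKI with the same \<open>Q\<close>.\<close>
    have "leading_eigenvectors (Q\<^sup>T * A * A\<^sup>T * Q) k (rev_cols (submatrix U' UNIV ind))"
      unfolding ind_def by (rule eig_leading_eigenvectors[OF D _ k]) (use Q[OF o] A in auto)
    then have "BKI A \<Omega> k s p (Q * rev_cols (submatrix U' UNIV ind))"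
      unfolding BKI_def using o by blast
    moreover have "P = (Q * rev_cols (submatrix U' UNIV ind),
        Q * rev_cols (submatrix U' UNIV ind) * (Q * rev_cols (submatrix U' UNIV ind))\<^sup>T * A)"
      unfolding P using outputs[OF o E USV refl] by simp
    ultimately show "P \<in> {(Z, Z * Z\<^sup>T * A) | Z. BKI A \<Omega> k s p Z}" by blast
  next
    fix P assume "P \<in> {(Z, Z * Z\<^sup>T * A) | Z. BKI A \<Omega> k s p Z}"
    then obtain Z Q W where P: "P = (Z, Z * Z\<^sup>T * A)" and o: "orth (krylov A \<Omega> p) Q"
      and W: "leading_eigenvectors (Q\<^sup>T * A * A\<^sup>T * Q) k W" and Z: "Z = Q * W"
      unfolding BKI_def by blast
    have M: "Q\<^sup>T * A * A\<^sup>T * Q \<in> carrier_mat q q" using Q[OF o] A by auto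
    have Msym: "(Q\<^sup>T * A * A\<^sup>T * Q)\<^sup>T = Q\<^sup>T * A * A\<^sup>T * Q"
      unfolding gram[OF o, symmetric]
      using transpose_mult[of "(Q\<^sup>T * A)\<^sup>T\<^sup>T" q n "(Q\<^sup>T * A)\<^sup>T" q] C[OF o] by simp
    \<comment> \<open>Conversely, the given eigenvectors determine the trailing columns of some
      \<open>U'\<close>; full column rank then supplies \<open>S'\<close> and \<open>V'\<close>, and
      any valid sequence of LU outputs admits the same \<open>Q\<close>.\<close>
    obtain U' D where D: "eig (Q\<^sup>T * A * A\<^sup>T * Q) U' D" and W_eq: "rev_cols (submatrix U' UNIV ind) = W"
      unfolding ind_def by (rule leading_eigenvectors_extend_eig[OF M Msym k W])
    obtain V' S' where E: "eigSVD (Q\<^sup>T * A)\<^sup>T V' S' U'"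
      using eigSVD_exists[OF C[OF o] rkC[OF o] D[folded gram[OF o]]] .
    obtain H where H: "lu_fst (A * \<Omega>) (H 0)" "\<forall>i\<in>{1..p}. lu_fst (A * (A\<^sup>T * H (i - 1))) (H i)"
      by (rule lu_blocks_exist[OF A \<Omega> rk])
    have oH: "orth (hcat (dim_row A) (map H [0..<Suc p])) Q"
      using lu_blocks_orth_iff[OF A \<Omega> H] o A by simp
    define U S V where "U = Q * submatrix U' UNIV ind" and "S = submatrix S' ind ind"
      and "V = submatrix V' UNIV ind"
    have "rSVD_BKI A \<Omega> k s p U S V"
      unfolding rSVD_BKI_def Let_def
      using H oH E U_def S_def V_def unfolding ind_def q_def by blast
    moreover have "P = (rev_cols U, U * S * V\<^sup>T)"
      using outputs[OF o E U_def S_def V_def] unfolding P Z W_eq by simp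
    ultimately show "P \<in> (\<lambda>(X, Y). (rev_cols X, Y)) ` {(U, U * S * V\<^sup>T) | U S V. rSVD_BKI A \<Omega> k s p U S V}"
      by (auto simp: image_iff)
  qed
qed

end
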